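(* $\mathrm{PrCat}(\omega*\eta)=\mathrm{Cone}(\Delta^0_3)$.
   Context: $\eta$ is the order type of the rationals and $\omega$ that of the naturals. For linear orders $L_0,L_1$, $L_0*L_1$ is the linear order obtained by replacing each point of $L_1$ with a copy of $L_0$; thus $\omega*\eta$ is a dense-without-endpoints sequence of copies of $\omega$. A structure is punctual if its domain is $\omega$ and its relations are uniformly primitive recursive. For total $f,g:\omega\to\omega$, write $f\le_{PR}g$ if $f$ is primitive recursive relative to $g$; the induced equivalence classes are PR-degrees, and $f\le_{PR}\mathbf d$ means $f\le_{PR}$ a member of $\mathbf d$. For a punctual structure $A$, $\mathrm{PrCat}(A)$ is the set of PR-degrees $\mathbf d$ such that for every punctual $B\cong A$ there is an isomorphism $f:A\to B$ with $f\le_{PR}\mathbf d$ and $f^{-1}\le_{PR}\mathbf d$; for an isomorphism type $S$ with a punctual presentation, $\mathrm{PrCat}(S)$ means $\mathrm{PrCat}(A)$ for a punctual $A\cong S$ (this does not depend on the choice of $A$). $\mathrm{Cone}(\Delta^0_3)$ is the set of PR-degrees $\mathbf d$ such that $f\le_{PR}\mathbf d$ for every total $\Delta^0_3$ function $f:\omega\to\omega$. *)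

theory Defs
  imports Complex_Main
begin

section \<open>Primitive recursive and computable functions\<close>

text \<open>
  A \<open>k\<close>-ary function on the naturals is a function on lists that matters only on lists of length
  \<open>k\<close>; the clause \<open>ext\<close> makes its values on lists of other lengths irrelevant.
  The set \<open>X\<close> contains the oracles. It is empty for the primitive recursive functions.
\<close>

inductive prim_rec_over :: "(nat \<Rightarrow> nat) set \<Rightarrow> nat \<Rightarrow> (nat list \<Rightarrow> nat) \<Rightarrow> bool"
  for X :: "(nat \<Rightarrow> nat) set" where
  zero: "prim_rec_over X k (\<lambda>xs. 0)"
| succ: "prim_rec_over X 1 (\<lambda>xs. Suc (xs ! 0))"
| proj: "i < k \<Longrightarrow> prim_rec_over X k (\<lambda>xs. xs ! i)"
| query: "g \<in> X \<Longrightarrow> prim_rec_over X 1 (\<lambda>xs. g (xs ! 0))"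
| comp: "prim_rec_over X (length fs) h \<Longrightarrow> (\<forall>f \<in> set fs. prim_rec_over X k f) \<Longrightarrow>
    prim_rec_over X k (\<lambda>xs. h (map (\<lambda>f. f xs) fs))"
| prec: "prim_rec_over X k b \<Longrightarrow> prim_rec_over X (Suc (Suc k)) s \<Longrightarrow>
    prim_rec_over X (Suc k)
      (\<lambda>xs. rec_nat (b (tl xs)) (\<lambda>m r. s (m # r # tl xs)) (hd xs))"
| ext: "prim_rec_over X k f \<Longrightarrow> (\<forall>xs. length xs = k \<longrightarrow> f' xs = f xs) \<Longrightarrow>
    prim_rec_over X k f'"

text \<open>
  Total computable functions: minimization is only applied when it yields a total function.
\<close>

inductive computable :: "nat \<Rightarrow> (nat list \<Rightarrow> nat) \<Rightarrow> bool" where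
  zero: "computable k (\<lambda>xs. 0)"
| succ: "computable 1 (\<lambda>xs. Suc (xs ! 0))"
| proj: "i < k \<Longrightarrow> computable k (\<lambda>xs. xs ! i)"
| comp: "computable (length fs) h \<Longrightarrow> (\<forall>f \<in> set fs. computable k f) \<Longrightarrow>
    computable k (\<lambda>xs. h (map (\<lambda>f. f xs) fs))"
| prec: "computable k b \<Longrightarrow> computable (Suc (Suc k)) s \<Longrightarrow>
    computable (Suc k) (\<lambda>xs. rec_nat (b (tl xs)) (\<lambda>m r. s (m # r # tl xs)) (hd xs))"
| minim: "computable (Suc k) h \<Longrightarrow> (\<forall>xs. length xs = k \<longrightarrow> (\<exists>y. h (y # xs) = 0)) \<Longrightarrow>
    computable k (\<lambda>xs. LEAST y. h (y # xs) = 0)"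
| ext: "computable k f \<Longrightarrow> (\<forall>xs. length xs = k \<longrightarrow> f' xs = f xs) \<Longrightarrow> computable k f'"


section \<open>PR-degrees\<close>

definition pr_le :: "(nat \<Rightarrow> nat) \<Rightarrow> (nat \<Rightarrow> nat) \<Rightarrow> bool" (infix \<open>\<le>\<^sub>P\<^sub>R\<close> 50)
  where "f \<le>\<^sub>P\<^sub>R g \<longleftrightarrow> prim_rec_over {g} 1 (\<lambda>xs. f (xs ! 0))"

definition pr_equiv :: "((nat \<Rightarrow> nat) \<times> (nat \<Rightarrow> nat)) set"
  where "pr_equiv = {(f, g). f \<le>\<^sub>P\<^sub>R g \<and> g \<le>\<^sub>P\<^sub>R f}"

definition pr_degrees :: "(nat \<Rightarrow> nat) set set"
  where "pr_degrees = UNIV // pr_equiv"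

definition pr_le_degree :: "(nat \<Rightarrow> nat) \<Rightarrow> (nat \<Rightarrow> nat) set \<Rightarrow> bool"
  where "pr_le_degree f d \<longleftrightarrow> (\<exists>g \<in> d. f \<le>\<^sub>P\<^sub>R g)"

lemma pr_le_refl: "f \<le>\<^sub>P\<^sub>R f"
  unfolding pr_le_def by (rule prim_rec_over.query) simp

lemma prim_rec_over_change:
  assumes "prim_rec_over {g} k h" "g \<le>\<^sub>P\<^sub>R g'"
  shows "prim_rec_over {g'} k h"
  using assms(1)
proof induction
  case (query g0)
  then show ?case using assms(2) by (simp add: pr_le_def)
next
  case succ
  show ?case by (rule prim_rec_over.succ)
qed (auto intro: prim_rec_over.intros)

lemma pr_le_trans: "f \<le>\<^sub>P\<^sub>R g \<Longrightarrow> g \<le>\<^sub>P\<^sub>R h \<Longrightarrow> f \<le>\<^sub>P\<^sub>R h"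
  using prim_rec_over_change pr_le_def by blast

lemma equiv_pr_equiv: "equiv UNIV pr_equiv"
  by (auto intro!: equivI refl_onI symI transI simp: pr_equiv_def pr_le_refl
      intro: pr_le_trans)


section \<open>The arithmetical hierarchy\<close>

text \<open>
  Relations of arity \<open>k\<close> are predicates on lists of length \<open>k\<close>. A relation is \<open>\<Pi>\<^sub>n\<close> if its
  complement is \<open>\<Sigma>\<^sub>n\<close>, so the predicate \<open>S\<close> in the second equation is \<open>\<Pi>\<^sub>n\<close>.
\<close>

fun arith_sigma :: "nat \<Rightarrow> nat \<Rightarrow> (nat list \<Rightarrow> bool) \<Rightarrow> bool" where
  "arith_sigma 0 k R \<longleftrightarrow> computable k (\<lambda>xs. of_bool (R xs))"
| "arith_sigma (Suc n) k R \<longleftrightarrow>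
    (\<exists>S. arith_sigma n (Suc k) (\<lambda>ys. \<not> S ys) \<and>
      (\<forall>xs. length xs = k \<longrightarrow> (R xs \<longleftrightarrow> (\<exists>y. S (y # xs)))))"

definition arith_pi :: "nat \<Rightarrow> nat \<Rightarrow> (nat list \<Rightarrow> bool) \<Rightarrow> bool"
  where "arith_pi n k R \<longleftrightarrow> arith_sigma n k (\<lambda>xs. \<not> R xs)"

definition arith_delta :: "nat \<Rightarrow> nat \<Rightarrow> (nat list \<Rightarrow> bool) \<Rightarrow> bool"
  where "arith_delta n k R \<longleftrightarrow> arith_sigma n k R \<and> arith_pi n k R"

text \<open>A total function is \<open>\<Delta>\<^sub>n\<close> if its graph is.\<close>

definition delta_functions :: "nat \<Rightarrow> (nat \<Rightarrow> nat) set"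
  where "delta_functions n = {f. arith_delta n 2 (\<lambda>xs. f (xs ! 0) = xs ! 1)}"


section \<open>Punctual presentations and punctual categoricity\<close>

text \<open>
  Linear orders are structures with one binary relation, read as the reflexive order, on a whole
  type. Punctual structures live on \<^typ>\<open>nat\<close>. Having only one relation makes the uniformity in
  the primitive recursiveness of the relations automatic.
\<close>

definition isomorphism :: "('a \<Rightarrow> 'a \<Rightarrow> bool) \<Rightarrow> ('b \<Rightarrow> 'b \<Rightarrow> bool) \<Rightarrow> ('a \<Rightarrow> 'b) \<Rightarrow> bool"
  where "isomorphism A B f \<longleftrightarrow> bij f \<and> (\<forall>x y. A x y \<longleftrightarrow> B (f x) (f y))"

definition isomorphic :: "('a \<Rightarrow> 'a \<Rightarrow> bool) \<Rightarrow> ('b \<Rightarrow> 'b \<Rightarrow> bool) \<Rightarrow> bool"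
  where "isomorphic A B \<longleftrightarrow> (\<exists>f. isomorphism A B f)"

definition punctual :: "(nat \<Rightarrow> nat \<Rightarrow> bool) \<Rightarrow> bool"
  where "punctual A \<longleftrightarrow> prim_rec_over {} 2 (\<lambda>xs. of_bool (A (xs ! 0) (xs ! 1)))"

definition PrCat :: "(nat \<Rightarrow> nat \<Rightarrow> bool) \<Rightarrow> (nat \<Rightarrow> nat) set set"
  where "PrCat A = {d \<in> pr_degrees. \<forall>B. punctual B \<and> isomorphic B A \<longrightarrow>
    (\<exists>f. isomorphism A B f \<and> pr_le_degree f d \<and> pr_le_degree (inv f) d)}"

definition Cone :: "(nat \<Rightarrow> nat) set \<Rightarrow> (nat \<Rightarrow> nat) set set"
  where "Cone F = {d \<in> pr_degrees. \<forall>f \<in> F. pr_le_degree f d}"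

text \<open>
  Each point of \<open>L1\<close> is replaced by a copy of \<open>L0\<close>, so the second components are compared first.
\<close>

definition order_times ::
    "('a \<Rightarrow> 'a \<Rightarrow> bool) \<Rightarrow> ('b \<Rightarrow> 'b \<Rightarrow> bool) \<Rightarrow> 'a \<times> 'b \<Rightarrow> 'a \<times> 'b \<Rightarrow> bool"
  where "order_times L0 L1 p q \<longleftrightarrow>
    (L1 (snd p) (snd q) \<and> snd p \<noteq> snd q) \<or> (snd p = snd q \<and> L0 (fst p) (fst q))"

definition omega_eta :: "nat \<times> rat \<Rightarrow> nat \<times> rat \<Rightarrow> bool"
  where "omega_eta = order_times (\<le>) (\<le>)"

end

theory Submission
  imports Defs "HOL-Library.Nat_Bijection" "HOL-Library.Countable_Set" "HOL-Library.Infinite_Set"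
    "HOL-Library.Product_Lexorder"
begin

text \<open>
  Whether two points of a punctual copy of \<open>\<omega> * \<eta>\<close> lie in the same block is \<open>\<Sigma>\<^sub>2\<close>, and the
  position of a point in its block is \<open>\<Delta>\<^sub>3\<close>. Hence the back-and-forth construction that matches
  blocks and positions yields isomorphisms whose graph is \<open>\<Sigma>\<^sub>3\<close>, so they and their inverses are
  \<open>\<Delta>\<^sub>3\<close> functions.

  Conversely, let \<open>g\<close> be \<open>\<Delta>\<^sub>3\<close>, so that \<open>g n = y\<close> iff some \<open>\<Pi>\<^sub>2\<close> event \<open>(n, j)\<close> with \<open>j\<close> coding \<open>y\<close>
  happens. A punctual copy contains points \<open>\<dots> < b (n, 2) < b (n, 1) < b (n, 0)\<close> such that
  \<open>b (n, j + 1)\<close> and \<open>b (n, j)\<close> are in different blocks iff the event \<open>(n, j)\<close> happens. Let \<open>h\<close> be an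
  isomorphism to a copy whose blocks are primitive recursive and each ordered like the codes of
  its points. If \<open>j\<close> is least such that \<open>(n, j)\<close> happens, then \<open>b (n, 0), \<dots>, b (n, j)\<close> are in one
  block, so \<open>j \<le> h (b (n, 0))\<close>. So a bounded search with oracle \<open>h\<close> finds \<open>j\<close> and thereby \<open>g n\<close>.
\<close>

section \<open>Primitive recursive functions on codes\<close>

lemma prim_rec_over_reindex:
  assumes "prim_rec_over X (length js) h" "\<forall>i\<in>set js. i < k"
  shows "prim_rec_over X k (\<lambda>xs. h (map (\<lambda>i. xs ! i) js))"
proof -
  have "prim_rec_over X k (\<lambda>xs. h (map (\<lambda>f. f xs) (map (\<lambda>i xs. xs ! i) js)))"
    using assms by (intro prim_rec_over.comp) (auto intro: prim_rec_over.proj)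
  then show ?thesis by (simp add: comp_def)
qed

text \<open>Closure rules for functions of one number apply to arbitrary terms in one variable;
  further arguments are packed into that variable by pairing.\<close>

definition pr_fun :: "(nat \<Rightarrow> nat) set \<Rightarrow> (nat \<Rightarrow> nat) \<Rightarrow> bool"
  where "pr_fun X f \<longleftrightarrow> prim_rec_over X 1 (\<lambda>xs. f (xs ! 0))"

definition pr_fun2 :: "(nat \<Rightarrow> nat) set \<Rightarrow> (nat \<Rightarrow> nat \<Rightarrow> nat) \<Rightarrow> bool"
  where "pr_fun2 X f \<longleftrightarrow> prim_rec_over X 2 (\<lambda>xs. f (xs ! 0) (xs ! 1))"

lemma prim_rec_over_comp1:
  assumes "pr_fun X f" "prim_rec_over X k a"
  shows "prim_rec_over X k (\<lambda>xs. f (a xs))"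
  using prim_rec_over.comp[of X "[a]" "\<lambda>xs. f (xs ! 0)" k] assms
  by (simp add: pr_fun_def)

lemma prim_rec_over_comp2:
  assumes "pr_fun2 X f" "prim_rec_over X k a" "prim_rec_over X k b"
  shows "prim_rec_over X k (\<lambda>xs. f (a xs) (b xs))"
  using prim_rec_over.comp[of X "[a, b]" "\<lambda>xs. f (xs ! 0) (xs ! 1)" k] assms
  by (simp add: pr_fun2_def numeral_2_eq_2)

lemma pr_fun_id: "pr_fun X (\<lambda>x. x)"
  unfolding pr_fun_def by (rule prim_rec_over.proj) simp

lemma pr_fun_comp: "pr_fun X f \<Longrightarrow> pr_fun X a \<Longrightarrow> pr_fun X (\<lambda>x. f (a x))"
  using prim_rec_over_comp1[of X f 1 "\<lambda>xs. a (xs ! 0)"] by (simp add: pr_fun_def)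

lemma pr_fun_comp2:
  "pr_fun2 X f \<Longrightarrow> pr_fun X a \<Longrightarrow> pr_fun X b \<Longrightarrow> pr_fun X (\<lambda>x. f (a x) (b x))"
  using prim_rec_over_comp2[of X f 1 "\<lambda>xs. a (xs ! 0)" "\<lambda>xs. b (xs ! 0)"] by (simp add: pr_fun_def)

lemma pr_fun_Suc': "pr_fun X Suc"
  unfolding pr_fun_def by (rule prim_rec_over.succ)

lemmas pr_fun_Suc = pr_fun_comp[OF pr_fun_Suc']

lemma prim_rec_over_const: "prim_rec_over X k (\<lambda>xs. c)"
  by (induction c) (auto intro: prim_rec_over.zero prim_rec_over_comp1 pr_fun_Suc')

lemma pr_fun_const: "pr_fun X (\<lambda>x. c)"
  unfolding pr_fun_def by (rule prim_rec_over_const)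

lemma pr_fun2_rec:
  assumes "pr_fun X b" "prim_rec_over X 3 (\<lambda>xs. s (xs ! 0) (xs ! 1) (xs ! 2))"
  shows "pr_fun2 X (\<lambda>n x. rec_nat (b x) (\<lambda>m r. s m r x) n)"
proof -
  have "prim_rec_over X (Suc 1) (\<lambda>xs. rec_nat (b (tl xs ! 0))
      (\<lambda>m r. s ((m # r # tl xs) ! 0) ((m # r # tl xs) ! 1) ((m # r # tl xs) ! 2)) (hd xs))"
    using assms by (intro prim_rec_over.prec) (auto simp: pr_fun_def numeral_3_eq_3)
  from prim_rec_over.ext[OF this, of "\<lambda>xs. rec_nat (b (xs ! 1)) (\<lambda>m r. s m r (xs ! 1)) (xs ! 0)"]
  show ?thesis unfolding pr_fun2_def numeral_2_eq_2 by (fastforce simp: length_Suc_conv)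
qed

lemma pr_fun_rec0:
  assumes "pr_fun2 X s"
  shows "pr_fun X (\<lambda>n. rec_nat c s n)"
proof -
  have "prim_rec_over X (Suc 0) (\<lambda>xs. rec_nat c
      (\<lambda>m r. s ((m # r # tl xs) ! 0) ((m # r # tl xs) ! 1)) (hd xs))"
    using assms by (intro prim_rec_over.prec) 
      (auto simp: pr_fun2_def numeral_2_eq_2 prim_rec_over_const)
  from prim_rec_over.ext[OF this, of "\<lambda>xs. rec_nat c s (xs ! 0)"]
  show ?thesis unfolding pr_fun_def by (fastforce simp: length_Suc_conv)
qed

lemma pr_fun2_flip: "pr_fun2 X f \<Longrightarrow> pr_fun2 X (\<lambda>x y. f y x)"
  unfolding pr_fun2_def
  using prim_rec_over_reindex[of X "[1, 0]" "\<lambda>xs. f (xs ! 0) (xs ! 1)" 2]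
  by (simp add: numeral_2_eq_2)

lemma prim_rec_over_proj3:
  "prim_rec_over X 3 (\<lambda>xs. xs ! 0)" "prim_rec_over X 3 (\<lambda>xs. xs ! 1)"
  "prim_rec_over X 3 (\<lambda>xs. xs ! Suc 0)"
  "prim_rec_over X 3 (\<lambda>xs. xs ! 2)"
  by (auto intro: prim_rec_over.proj)

lemma pr_fun2_add: "pr_fun2 X (+)"
proof -
  have "pr_fun2 X (\<lambda>n x. rec_nat x (\<lambda>m r. Suc r) n)"
    by (rule pr_fun2_rec) (auto intro: pr_fun_id prim_rec_over_comp1 pr_fun_Suc' prim_rec_over_proj3)
  moreover have "rec_nat x (\<lambda>m r. Suc r) n = n + x" for n x by (induction n) auto
  ultimately show ?thesis by simp
qed

lemma pr_fun2_mult: "pr_fun2 X (*)"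
proof -
  have "pr_fun2 X (\<lambda>n x. rec_nat 0 (\<lambda>m r. r + x) n)"
    by (rule pr_fun2_rec) (auto intro: pr_fun_const prim_rec_over_comp2 pr_fun2_add prim_rec_over_proj3)
  moreover have "rec_nat 0 (\<lambda>m r. r + x) n = n * x" for n x by (induction n) auto
  ultimately show ?thesis by simp
qed

lemma pr_fun_pred: "pr_fun X (\<lambda>x. x - Suc 0)"
proof -
  have "pr_fun X (\<lambda>n. rec_nat 0 (\<lambda>m r. m) n)"
    by (rule pr_fun_rec0) (auto simp: pr_fun2_def intro: prim_rec_over.proj)
  moreover have "rec_nat 0 (\<lambda>m r. m) n = n - Suc 0" for n by (cases n) auto
  ultimately show ?thesis by simp
qed

lemma pr_fun2_diff: "pr_fun2 X (-)"
proof -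
  have "pr_fun2 X (\<lambda>n x. rec_nat x (\<lambda>m r. r - Suc 0) n)"
    by (rule pr_fun2_rec) (auto intro: pr_fun_id prim_rec_over_comp1 pr_fun_pred prim_rec_over_proj3)
  moreover have "rec_nat x (\<lambda>m r. r - Suc 0) n = x - n" for n x by (induction n) auto
  ultimately show ?thesis using pr_fun2_flip[of X "\<lambda>n x. x - n"] by simp
qed

lemmas pr_fun_add = pr_fun_comp2[OF pr_fun2_add]
lemmas pr_fun_mult = pr_fun_comp2[OF pr_fun2_mult]
lemmas pr_fun_diff = pr_fun_comp2[OF pr_fun2_diff]

section \<open>Primitive recursive predicates and definition by cases\<close>

abbreviation pr_pred :: "(nat \<Rightarrow> nat) set \<Rightarrow> (nat \<Rightarrow> bool) \<Rightarrow> bool"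
  where "pr_pred X P \<equiv> pr_fun X (\<lambda>x. of_bool (P x))"

lemma pr_pred_not:
  assumes "pr_pred X P"
  shows "pr_pred X (\<lambda>x. \<not> P x)"
proof -
  have "pr_fun X (\<lambda>x. 1 - of_bool (P x))"
    by (intro pr_fun_diff pr_fun_const assms)
  moreover have "1 - of_bool c = (of_bool (\<not> c) :: nat)" for c by simp
  ultimately show ?thesis by (simp only:)
qed

lemma pr_pred_conj: "pr_pred X P \<Longrightarrow> pr_pred X Q \<Longrightarrow> pr_pred X (\<lambda>x. P x \<and> Q x)"
  using pr_fun_mult[of X "\<lambda>x. of_bool (P x)" "\<lambda>x. of_bool (Q x)"]
  by (simp only: of_bool_conj)

lemma pr_pred_disj: "pr_pred X P \<Longrightarrow> pr_pred X Q \<Longrightarrow> pr_pred X (\<lambda>x. P x \<or> Q x)"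
  using pr_pred_not[OF pr_pred_conj[OF pr_pred_not pr_pred_not], of X P Q] by (simp only: de_Morgan_conj not_not)

lemma pr_pred_imp: "pr_pred X P \<Longrightarrow> pr_pred X Q \<Longrightarrow> pr_pred X (\<lambda>x. P x \<longrightarrow> Q x)"
  using pr_pred_disj[OF pr_pred_not, of X P Q] by (simp only: imp_conv_disj)

lemma pr_pred_le: "pr_fun X a \<Longrightarrow> pr_fun X b \<Longrightarrow> pr_pred X (\<lambda>x. a x \<le> b x)"
proof -
  assume *: "pr_fun X a" "pr_fun X b"
  have "pr_fun X (\<lambda>x. 1 - (a x - b x))"
    by (intro pr_fun_diff pr_fun_const *)
  moreover have "1 - (m - n) = of_bool (m \<le> n)" for m n :: nat by auto
  ultimately show ?thesis by simp
qed

lemma pr_pred_less: "pr_fun X a \<Longrightarrow> pr_fun X b \<Longrightarrow> pr_pred X (\<lambda>x. a x < b x)"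
  using pr_pred_le[OF pr_fun_Suc, of X a b] by (simp add: Suc_le_eq)

lemma pr_pred_eq: "pr_fun X a \<Longrightarrow> pr_fun X b \<Longrightarrow> pr_pred X (\<lambda>x. a x = b x)"
  using pr_pred_conj[OF pr_pred_le pr_pred_le, of X a b b a] by (simp add: eq_iff)

lemma pr_fun_if:
  assumes "pr_pred X P" "pr_fun X a" "pr_fun X b"
  shows "pr_fun X (\<lambda>x. if P x then a x else b x)"
proof -
  have "pr_fun X (\<lambda>x. of_bool (P x) * a x + (1 - of_bool (P x)) * b x)"
    by (intro pr_fun_add pr_fun_mult pr_fun_diff pr_fun_const assms)
  moreover have "of_bool c * m + (1 - of_bool c) * n = (if c then m else n)" for c and m n :: nat
    by simp
  ultimately show ?thesis by simp
qed

section \<open>The Cantor pairing function and its projections\<close>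

definition pair :: "nat \<Rightarrow> nat \<Rightarrow> nat" where "pair a b = prod_encode (a, b)"
definition pfst :: "nat \<Rightarrow> nat" where "pfst z = fst (prod_decode z)"
definition psnd :: "nat \<Rightarrow> nat" where "psnd z = snd (prod_decode z)"

lemma pfst_pair [simp]: "pfst (pair a b) = a"
  and psnd_pair [simp]: "psnd (pair a b) = b"
  and pair_pfst_psnd [simp]: "pair (pfst z) (psnd z) = z"
  by (auto simp: pair_def pfst_def psnd_def)

lemma pair_inject [simp]: "pair a b = pair c d \<longleftrightarrow> a = c \<and> b = d"
  by (simp add: pair_def)

text \<open>The largest \<open>r\<close> with \<open>triangle r \<le> z\<close>. One test per step
  suffices, since the root grows by at most one when \<open>z\<close> does.\<close>

definition tri_root :: "nat \<Rightarrow> nat" where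
  "tri_root z = rec_nat 0 (\<lambda>m r. if triangle (Suc r) \<le> Suc m then Suc r else r) z"

lemma pr_fun_triangle: "pr_fun X triangle"
proof -
  have "pr_fun X (\<lambda>n. rec_nat 0 (\<lambda>m r. r + Suc m) n)"
    by (rule pr_fun_rec0)
      (auto simp: pr_fun2_def intro!: prim_rec_over_comp2[OF pr_fun2_add] prim_rec_over_comp1[OF pr_fun_Suc']
        prim_rec_over.proj)
  moreover have "rec_nat 0 (\<lambda>m r. r + Suc m) n = triangle n" for n
    by (induction n) auto
  ultimately show ?thesis by simp
qed

lemma pr_fun2_pair: "pr_fun2 X pair"
  unfolding pr_fun2_def pair_def prod_encode_def prod.case
  by (intro prim_rec_over_comp2[OF pr_fun2_add] prim_rec_over_comp1[OF pr_fun_triangle]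
      prim_rec_over.proj) auto

lemmas pr_fun_pair = pr_fun_comp2[OF pr_fun2_pair]

lemma pr_fun_tri_root: "pr_fun X tri_root"
proof -
  have "pr_fun2 X (\<lambda>m r. r + of_bool (triangle (Suc r) \<le> Suc m))"
  proof -
    have "pr_fun2 X (\<lambda>m r. r + (1 - (triangle (Suc r) - Suc m)))"
      unfolding pr_fun2_def
      by (intro prim_rec_over_comp2[OF pr_fun2_add] prim_rec_over_comp2[OF pr_fun2_diff]
          prim_rec_over_comp1[OF pr_fun_triangle] prim_rec_over_comp1[OF pr_fun_Suc']
          prim_rec_over.proj prim_rec_over_const) auto
    moreover have "1 - (m - n) = of_bool (m \<le> n)" for m n :: nat by auto
    ultimately show ?thesis by simp
  qed
  moreover have "(\<lambda>m r. r + of_bool (triangle (Suc r) \<le> Suc m)) =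
      (\<lambda>m r. if triangle (Suc r) \<le> Suc m then Suc r else r)"
    by (simp add: fun_eq_iff)
  ultimately have "pr_fun2 X (\<lambda>m r. if triangle (Suc r) \<le> Suc m then Suc r else r)"
    by (simp only:)
  from pr_fun_rec0[OF this, of 0] show ?thesis unfolding tri_root_def [abs_def] .
qed

lemma tri_root_bounds: "triangle (tri_root z) \<le> z \<and> z < triangle (Suc (tri_root z))"
  by (induction z) (auto simp: tri_root_def)

lemma tri_root_eq: "tri_root (prod_encode (a, b)) = a + b"
proof -
  let ?z = "prod_encode (a, b)"
  have mono: "triangle m \<le> triangle n" if "m \<le> n" for m n
    using that by (induction rule: dec_induct) auto
  have "triangle (a + b) \<le> ?z" "?z < triangle (Suc (a + b))"
    by (auto simp: prod_encode_def)
  with tri_root_bounds[of ?z] mono[of "Suc (a+b)" "tri_root ?z"] mono[of "Suc (tri_root ?z)" "a+b"]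
  show ?thesis by linarith
qed

text \<open>The pair \<open>(a, b)\<close> is coded by \<open>triangle (a + b) + a\<close>, so the
  triangular root of the code is \<open>a + b\<close>. These formulas make the projections primitive
  recursive.\<close>

lemma pfst_eq: "pfst z = z - triangle (tri_root z)"
  and psnd_eq: "psnd z = tri_root z - pfst z"
proof -
  obtain a b where z: "z = prod_encode (a, b)" by (metis prod_decode_inverse surj_pair)
  show "pfst z = z - triangle (tri_root z)"
    unfolding z tri_root_eq by (simp add: pfst_def) (simp add: prod_encode_def)
  show "psnd z = tri_root z - pfst z"
    unfolding z tri_root_eq by (simp add: pfst_def psnd_def)
qed

lemma pr_fun_pfst: "pr_fun X a \<Longrightarrow> pr_fun X (\<lambda>x. pfst (a x))"
  unfolding pfst_eq
  by (intro pr_fun_diff pr_fun_comp[OF pr_fun_triangle] pr_fun_comp[OF pr_fun_tri_root])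

lemma pr_fun_psnd: "pr_fun X a \<Longrightarrow> pr_fun X (\<lambda>x. psnd (a x))"
  unfolding psnd_eq by (intro pr_fun_diff pr_fun_comp[OF pr_fun_tri_root] pr_fun_pfst)

section \<open>Recursion, bounded sums, bounded quantifiers and bounded search on codes\<close>

lemma pr_fun_rec:
  assumes "pr_fun X b" "pr_fun X t" "pr_fun X (\<lambda>z. s (pfst z) (pfst (psnd z)) (psnd (psnd z)))"
  shows "pr_fun X (\<lambda>x. rec_nat (b x) (\<lambda>m r. s m r x) (t x))"
proof -
  have "prim_rec_over X 3 (\<lambda>xs. (\<lambda>z. s (pfst z) (pfst (psnd z)) (psnd (psnd z)))
      (pair (xs ! 0) (pair (xs ! 1) (xs ! 2))))"
    by (intro prim_rec_over_comp1[OF assms(3)] prim_rec_over_comp2[OF pr_fun2_pair] prim_rec_over_proj3)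
  then have "pr_fun2 X (\<lambda>n x. rec_nat (b x) (\<lambda>m r. s m r x) n)"
    by (intro pr_fun2_rec assms(1)) simp
  from pr_fun_comp2[OF this assms(2) pr_fun_id] show ?thesis .
qed

lemma pr_fun_sum:
  assumes "pr_fun X (\<lambda>z. f (pfst z) (psnd z))" "pr_fun X t"
  shows "pr_fun X (\<lambda>x. \<Sum>i<t x. f i x)"
proof -
  have "pr_fun X (\<lambda>x. rec_nat 0 (\<lambda>m r. r + f m x) (t x))"
    using pr_fun_comp[OF assms(1) pr_fun_pair[OF pr_fun_pfst[OF pr_fun_id] pr_fun_psnd[OF pr_fun_psnd[OF pr_fun_id]]]]
    by (intro pr_fun_rec assms pr_fun_const pr_fun_add pr_fun_pfst pr_fun_psnd pr_fun_id) simp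
  moreover have "rec_nat 0 (\<lambda>m r. r + f m x) n = (\<Sum>i<n. f i x)" for n x
    by (induction n) auto
  ultimately show ?thesis by simp
qed

lemma pr_pred_bex:
  assumes "pr_pred X (\<lambda>z. P (pfst z) (psnd z))" "pr_fun X t"
  shows "pr_pred X (\<lambda>x. \<exists>i<t x. P i x)"
proof -
  have "pr_pred X (\<lambda>x. 0 < (\<Sum>i<t x. of_bool (P i x) :: nat))"
    by (intro pr_pred_less pr_fun_sum pr_fun_const assms)
  moreover have "0 < (\<Sum>i<n. of_bool (P i x) :: nat) \<longleftrightarrow> (\<exists>i<n. P i x)" for n x
    by (induction n) (auto simp: less_Suc_eq)
  ultimately show ?thesis by simp
qed

lemma pr_pred_ball:
  assumes "pr_pred X (\<lambda>z. P (pfst z) (psnd z))" "pr_fun X t"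
  shows "pr_pred X (\<lambda>x. \<forall>i<t x. P i x)"
  using pr_pred_not[OF pr_pred_bex[OF pr_pred_not[OF assms(1)] assms(2)]] by simp

text \<open>The least witness is the number of \<open>i \<le> t x\<close> with no witness
  \<open>j \<le> i\<close>, so a bounded search is a bounded sum.\<close>

lemma pr_fun_least:
  assumes "pr_pred X (\<lambda>z. P (pfst z) (psnd z))" "pr_fun X t" "\<And>x. \<exists>i\<le>t x. P i x"
  shows "pr_fun X (\<lambda>x. LEAST i. P i x)"
proof -
  have "pr_fun X (\<lambda>x. \<Sum>i<Suc (t x). of_bool (\<forall>j<Suc i. \<not> P j x))"
    using pr_fun_comp[OF assms(1) pr_fun_pair[OF pr_fun_pfst[OF pr_fun_id] pr_fun_psnd[OF pr_fun_psnd[OF pr_fun_id]]]]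
    by (intro pr_fun_sum pr_pred_ball pr_pred_not pr_fun_Suc pr_fun_pfst pr_fun_id assms) simp
  moreover have "(\<Sum>i<Suc (t x). of_bool (\<forall>j<Suc i. \<not> P j x)) = (LEAST i. P i x)" for x
  proof -
    obtain i where i: "i \<le> t x" "P i x" using assms(3) by blast
    let ?m = "LEAST i. P i x"
    have m: "?m \<le> t x" "P ?m x" using i by (auto intro: LeastI order.trans[OF Least_le])
    have "(\<forall>j<Suc i. \<not> P j x) \<longleftrightarrow> i < ?m" for i
    proof
      assume "\<forall>j<Suc i. \<not> P j x"
      then show "i < ?m" using m(2) by (metis less_Suc_eq_le not_less)
    next
      assume "i < ?m"
      then show "\<forall>j<Suc i. \<not> P j x" by (metis less_Suc_eq_le le_less_trans not_less_Least)
    qed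
    then have "(\<Sum>i<Suc (t x). of_bool (\<forall>j<Suc i. \<not> P j x)) =
        (\<Sum>i\<in>{..<Suc (t x)}. if i < ?m then 1 else 0)"
      by (intro sum.cong) auto
    also have "\<dots> = card {i. i < Suc (t x) \<and> i < ?m}"
      by (subst sum.If_cases) (auto simp: Int_def)
    also have "{i. i < Suc (t x) \<and> i < ?m} = {..<?m}" using m(1) by auto
    finally show ?thesis by simp
  qed
  ultimately show ?thesis by simp
qed

lemmas pr_fun_intros = pr_fun_id pr_fun_const pr_fun_Suc pr_fun_add pr_fun_mult pr_fun_diff pr_fun_if pr_fun_pair pr_fun_pfst pr_fun_psnd
  pr_fun_sum pr_pred_not pr_pred_conj pr_pred_disj pr_pred_imp pr_pred_le pr_pred_less pr_pred_eq pr_pred_bex pr_pred_ball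


section \<open>The arithmetical hierarchy on codes\<close>

text \<open>Tuples are coded by one number, and the matrix is primitive recursive rather than
  computable. From level one on this makes no difference: \<open>Sig_arith_sigma\<close> and
  \<open>arith_sigma_Sig\<close> translate between the two hierarchies.\<close>

fun Sig :: "nat \<Rightarrow> (nat \<Rightarrow> bool) \<Rightarrow> bool" where
  "Sig 0 P \<longleftrightarrow> pr_pred {} P"
| "Sig (Suc n) P \<longleftrightarrow> (\<exists>Q. Sig n (\<lambda>z. \<not> Q z) \<and> (\<forall>x. P x \<longleftrightarrow> (\<exists>y. Q (pair y x))))"

lemma Sig_subst: "Sig n P \<Longrightarrow> pr_fun {} f \<Longrightarrow> Sig n (\<lambda>x. P (f x))"
proof (induction n arbitrary: P f)
  case 0
  then show ?case using pr_fun_comp[of "{}" "\<lambda>x. of_bool (P x)" f] by simp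
next
  case (Suc n)
  then obtain Q where Q: "Sig n (\<lambda>z. \<not> Q z)" "\<And>x. P x \<longleftrightarrow> (\<exists>y. Q (pair y x))" by auto
  have "Sig n (\<lambda>z. \<not> Q (pair (pfst z) (f (psnd z))))"
    by (intro Suc.IH[OF Q(1), of "\<lambda>z. pair (pfst z) (f (psnd z))"] pr_fun_intros
        pr_fun_comp[OF Suc.prems(2)])
  then show ?case using Q(2) by (auto intro!: exI[of _ "\<lambda>z. Q (pair (pfst z) (f (psnd z)))"])
qed

lemma Sig_subst_cong: "Sig n P \<Longrightarrow> pr_fun {} f \<Longrightarrow> (\<And>x. Q x \<longleftrightarrow> P (f x)) \<Longrightarrow> Sig n Q"
  using Sig_subst[of n P f] by presburger

lemma Sig_pr_pred: "pr_pred {} P \<Longrightarrow> Sig n P"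
proof (induction n arbitrary: P)
  case (Suc n)
  have "Sig n (\<lambda>z. \<not> P (psnd z))"
    by (intro Suc.IH pr_pred_not pr_fun_comp[OF Suc.prems] pr_fun_intros)
  then show ?case by (auto intro!: exI[of _ "\<lambda>z. P (psnd z)"])
qed simp

text \<open>The dummy quantifier is added innermost, next to the primitive recursive matrix, so the
  outer quantifiers keep their form.\<close>

lemma Sig_Suc: "Sig n P \<Longrightarrow> Sig (Suc n) P"
proof (induction n arbitrary: P)
  case 0
  then show ?case by (intro Sig_pr_pred) simp
next
  case (Suc n)
  from Suc.prems obtain Q where Q: "Sig n (\<lambda>z. \<not> Q z)" "\<And>x. P x \<longleftrightarrow> (\<exists>y. Q (pair y x))" by auto
  then have "Sig (Suc n) (\<lambda>z. \<not> Q z)" by (intro Suc.IH)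
  with Q(2) show ?case by (simp only: Sig.simps(2)[of "Suc n"]) blast
qed

lemma Sig_mono: "Sig m P \<Longrightarrow> m \<le> n \<Longrightarrow> Sig n P"
  by (induction n) (auto simp: le_Suc_eq simp del: Sig.simps intro: Sig_Suc)

text \<open>Here the dummy quantifier is outermost, which turns a \<Pi>-form into the \<Sigma>-form
  of the next level.\<close>

lemma Sig_Suc_not: "Sig n (\<lambda>x. \<not> P x) \<Longrightarrow> Sig (Suc n) P"
  using Sig_subst[of n "\<lambda>x. \<not> P x" psnd] pr_fun_psnd[OF pr_fun_id]
  by (auto intro!: exI[of _ "\<lambda>z. P (psnd z)"])

text \<open>One induction proves all four, because negating the matrix exchanges conjunction with
  disjunction and the two bounded quantifiers with each other.\<close>

lemma
  shows Sig_conj: "Sig n P \<Longrightarrow> Sig n Q \<Longrightarrow> Sig n (\<lambda>x. P x \<and> Q x)"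
    and Sig_disj: "Sig n P \<Longrightarrow> Sig n Q \<Longrightarrow> Sig n (\<lambda>x. P x \<or> Q x)"
    and Sig_ball: "Sig n P \<Longrightarrow> pr_fun {} t \<Longrightarrow> Sig n (\<lambda>x. \<forall>i<t x. P (pair i x))"
    and Sig_bex: "Sig n P \<Longrightarrow> pr_fun {} t \<Longrightarrow> Sig n (\<lambda>x. \<exists>i<t x. P (pair i x))"
proof (induction n arbitrary: P Q t)
  case 0
  {
    case 1 then show ?case by (auto intro: pr_pred_conj)
  next
    case 2 then show ?case unfolding Sig.simps by (rule pr_pred_disj)
  next
    case 3 then show ?case by (auto intro: pr_pred_ball)
  next
    case 4 then show ?case by (auto intro: pr_pred_bex)
  }
next
  case (Suc n)
  have ex: "\<exists>P'. Sig n (\<lambda>z. \<not> P' z) \<and> (\<forall>x. P x \<longleftrightarrow> (\<exists>y. P' (pair y x)))" if "Sig (Suc n) P" for P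
    using that by simp
  have intro: "Sig (Suc n) P" if "Sig n (\<lambda>z. \<not> P' z)" "\<And>x. P x \<longleftrightarrow> (\<exists>y. P' (pair y x))" for P P'
    using that by auto
  {
    case 1
    obtain P' Q' where
      P': "Sig n (\<lambda>z. \<not> P' z)" "\<And>x. P x \<longleftrightarrow> (\<exists>y. P' (pair y x))" and
      Q': "Sig n (\<lambda>z. \<not> Q' z)" "\<And>x. Q x \<longleftrightarrow> (\<exists>y. Q' (pair y x))"
      using ex[OF 1(1)] ex[OF 1(2)] by blast
    \<comment> \<open>One witness codes the witnesses of both conjuncts.\<close>
    let ?R = "\<lambda>z. P' (pair (pfst (pfst z)) (psnd z)) \<and> Q' (pair (psnd (pfst z)) (psnd z))"
    have "Sig n (\<lambda>z. \<not> P' (pair (pfst (pfst z)) (psnd z)) \<or> \<not> Q' (pair (psnd (pfst z)) (psnd z)))"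
      by (intro Suc.IH Sig_subst[OF P'(1)] Sig_subst[OF Q'(1)] pr_fun_intros)
    then have "Sig n (\<lambda>z. \<not> ?R z)" by simp
    moreover have "P x \<and> Q x \<longleftrightarrow> (\<exists>y. ?R (pair y x))" for x
      unfolding P'(2) Q'(2) by simp (metis pfst_pair psnd_pair)
    ultimately show ?case by (rule intro)
  next
    case 2
    obtain P' Q' where
      P': "Sig n (\<lambda>z. \<not> P' z)" "\<And>x. P x \<longleftrightarrow> (\<exists>y. P' (pair y x))" and
      Q': "Sig n (\<lambda>z. \<not> Q' z)" "\<And>x. Q x \<longleftrightarrow> (\<exists>y. Q' (pair y x))"
      using ex[OF 2(1)] ex[OF 2(2)] by blast
    have "Sig n (\<lambda>z. \<not> P' z \<and> \<not> Q' z)" by (intro Suc.IH P' Q')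
    then have "Sig n (\<lambda>z. \<not> (P' z \<or> Q' z))" by simp
    moreover have "P x \<or> Q x \<longleftrightarrow> (\<exists>y. P' (pair y x) \<or> Q' (pair y x))" for x
      unfolding P'(2) Q'(2) by blast
    ultimately show ?case by (rule intro)
  next
    case 3
    obtain P' where
      P': "Sig n (\<lambda>z. \<not> P' z)" "\<And>x. P x \<longleftrightarrow> (\<exists>y. P' (pair y x))"
      using ex[OF 3(1)] by blast
    \<comment> \<open>Finitely many witnesses have a common bound, so the unbounded quantifier moves
      in front of the bounded one; inside it only a bounded search remains.\<close>
    let ?S = "\<lambda>w. \<forall>y<pfst (psnd w). \<not> P' (pair y (pair (pfst w) (psnd (psnd w))))"
    let ?R = "\<lambda>z. \<forall>i<t (psnd z). \<exists>y<pfst z. P' (pair y (pair i (psnd z)))"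
    have "Sig n (\<lambda>w. \<forall>y<pfst (psnd w). (\<lambda>v. \<not> P' (pair (pfst v) (pair (pfst (psnd v)) (psnd (psnd (psnd v))))))
        (pair y w))"
      by (intro Suc.IH Sig_subst[OF P'(1)] pr_fun_intros)
    then have "Sig n ?S" by simp
    then have "Sig n (\<lambda>z. \<exists>i<t (psnd z). ?S (pair i z))"
      by (intro Suc.IH pr_fun_comp[OF 3(2)] pr_fun_intros)
    then have "Sig n (\<lambda>z. \<not> ?R z)" by simp
    moreover have "(\<forall>i<t x. P (pair i x)) \<longleftrightarrow> (\<exists>b. ?R (pair b x))" for x
    proof
      assume "\<forall>i<t x. P (pair i x)"
      then obtain f where f: "\<And>i. i < t x \<Longrightarrow> P' (pair (f i) (pair i x))"
        unfolding P'(2) by metis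
      have "f i < Suc (Max (f ` {..<t x}))" if "i < t x" for i
        using that by (auto simp: less_Suc_eq_le intro!: Max_ge)
      with f show "\<exists>b. ?R (pair b x)" by (intro exI[of _ "Suc (Max (f ` {..<t x}))"]) auto
    qed (use P'(2) in auto)
    ultimately show ?case by (rule intro)
  next
    case 4
    obtain P' where
      P': "Sig n (\<lambda>z. \<not> P' z)" "\<And>x. P x \<longleftrightarrow> (\<exists>y. P' (pair y x))"
      using ex[OF 4(1)] by blast
    let ?R = "\<lambda>z. pfst (pfst z) < t (psnd z) \<and> P' (pair (psnd (pfst z)) (pair (pfst (pfst z)) (psnd z)))"
    have "Sig n (\<lambda>z. \<not> pfst (pfst z) < t (psnd z) \<or>
        \<not> P' (pair (psnd (pfst z)) (pair (pfst (pfst z)) (psnd z))))"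
      by (intro Suc.IH Sig_subst[OF P'(1)] Sig_pr_pred pr_fun_intros pr_fun_comp[OF 4(2)])
    then have "Sig n (\<lambda>z. \<not> ?R z)" by simp
    moreover have "(\<exists>i<t x. P (pair i x)) \<longleftrightarrow> (\<exists>b. ?R (pair b x))" for x
      unfolding P'(2) by simp (metis pfst_pair psnd_pair)
    ultimately show ?case by (rule intro)
  }
qed

text \<open>Two adjacent existential quantifiers become one over pairs.\<close>

lemma Sig_ex:
  assumes "Sig (Suc n) (\<lambda>z. P (pfst z) (psnd z))"
  shows "Sig (Suc n) (\<lambda>x. \<exists>y. P y x)"
proof -
  from assms obtain Q where Q: "Sig n (\<lambda>z. \<not> Q z)"
    "\<And>x. P (pfst x) (psnd x) \<longleftrightarrow> (\<exists>y. Q (pair y x))" by auto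
  have "Sig n (\<lambda>z. \<not> Q (pair (pfst (pfst z)) (pair (psnd (pfst z)) (psnd z))))"
    by (intro Sig_subst[OF Q(1)] pr_fun_intros)
  moreover have "(\<exists>y. P y x) \<longleftrightarrow>
      (\<exists>y. Q (pair (pfst (pfst (pair y x))) (pair (psnd (pfst (pair y x))) (psnd (pair y x)))))" for x
    using Q(2)[of "pair _ x"] by simp (metis pfst_pair psnd_pair)
  ultimately show ?thesis
    by (auto intro!: exI[of _ "\<lambda>z. Q (pair (pfst (pfst z)) (pair (psnd (pfst z)) (psnd z)))"])
qed


section \<open>Computable relations on lists\<close>

fun dec :: "nat \<Rightarrow> nat \<Rightarrow> nat list" where
  "dec 0 z = []"
| "dec (Suc k) z = pfst z # dec k (psnd z)"

fun enc :: "nat list \<Rightarrow> nat" where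
  "enc [] = 0"
| "enc (x # xs) = pair x (enc xs)"

text \<open>Every number codes an infinite sequence, without a length. It is enough that every
  finite sequence is an initial part of such a sequence (\<open>seqnth_exists\<close>).\<close>

definition seqnth :: "nat \<Rightarrow> nat \<Rightarrow> nat"
  where "seqnth z i = pfst (rec_nat z (\<lambda>m r. psnd r) i)"

lemma length_dec [simp]: "length (dec k z) = k"
  by (induction k arbitrary: z) auto

lemma dec_enc: "dec (length xs) (enc xs) = xs"
  by (induction xs) auto

lemma rec_nat_psnd_Suc: "rec_nat z (\<lambda>m. psnd) (Suc i) = rec_nat (psnd z) (\<lambda>m. psnd) i"
  by (induction i) auto

lemma seqnth_Suc: "seqnth z (Suc i) = seqnth (psnd z) i"
  unfolding seqnth_def rec_nat_psnd_Suc ..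

lemma seqnth_enc: "i < length xs \<Longrightarrow> seqnth (enc xs) i = xs ! i"
  by (induction xs arbitrary: i) (auto simp: seqnth_Suc nth_Cons' seqnth_def[of _ 0] gr0_conv_Suc)

lemma seqnth_exists: "\<exists>z. \<forall>i<n. seqnth z i = f i"
  using seqnth_enc[of _ "map f [0..<n]"] by auto

lemma nth_dec: "i < k \<Longrightarrow> dec k z ! i = seqnth z i"
proof (induction k arbitrary: z i)
  case (Suc k)
  then show ?case by (cases i) (auto simp: seqnth_Suc seqnth_def[of _ 0])
qed simp

lemma pr_fun_seqnth: "pr_fun X a \<Longrightarrow> pr_fun X b \<Longrightarrow> pr_fun X (\<lambda>x. seqnth (a x) (b x))"
  unfolding seqnth_def by (intro pr_fun_intros pr_fun_rec)

text \<open>Composition quantifies over a code of the intermediate values, and recursion over a code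
  of the course of values. Minimization combines that \<open>h\<close> vanishes at the value with a
  bounded quantifier saying that it does not vanish earlier; both conditions are \<Sigma>_1.\<close>

lemma computable_Sig:
  assumes "computable k f"
  shows "Sig 1 (\<lambda>z. f (dec k (psnd z)) = pfst z)"
  using assms
proof induction
  case (zero k)
  show ?case by (intro Sig_pr_pred pr_fun_intros)
next
  case succ
  show ?case by (simp del: Sig.simps) (intro Sig_pr_pred pr_fun_intros)
next
  case (proj i k)
  then show ?case
    by (simp add: nth_dec del: Sig.simps) (intro Sig_pr_pred pr_fun_intros pr_fun_seqnth)
next
  case (comp fs h k)
  have "Sig 1 (\<lambda>w. map (\<lambda>f. f (dec k (psnd w))) gs = dec (length gs) (pfst w))"
    if "set gs \<subseteq> set fs" for gs
    using that
  proof (induction gs)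
    case Nil
    then show ?case by (intro Sig_pr_pred) (simp add: pr_fun_const)
  next
    case (Cons g gs)
    have g: "Sig 1 (\<lambda>w. g (dec k (psnd w)) = pfst w)"
      using comp.IH(2) Cons.prems by simp
    have gs: "set gs \<subseteq> set fs" using Cons.prems by simp
    have "Sig 1 (\<lambda>w. g (dec k (psnd w)) = pfst (pfst w))"
      by (rule Sig_subst_cong[OF g, of "\<lambda>w. pair (pfst (pfst w)) (psnd w)"])
      ((intro pr_fun_intros pr_fun_seqnth)[1], simp)
    moreover have "Sig 1 (\<lambda>w. map (\<lambda>f. f (dec k (psnd w))) gs = dec (length gs) (psnd (pfst w)))"
      by (rule Sig_subst_cong[OF Cons.IH[OF gs], of "\<lambda>w. pair (psnd (pfst w)) (psnd w)"])
      ((intro pr_fun_intros pr_fun_seqnth)[1], simp)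
    ultimately have "Sig 1 (\<lambda>w. g (dec k (psnd w)) = pfst (pfst w) \<and>
        map (\<lambda>f. f (dec k (psnd w))) gs = dec (length gs) (psnd (pfst w)))"
      by (rule Sig_conj)
    then show ?case by (simp del: Sig.simps)
  qed
  from this[OF order.refl]
  have 1: "Sig 1 (\<lambda>w. map (\<lambda>f. f (dec k (psnd (psnd w)))) fs = dec (length fs) (pfst w))"
    by (rule Sig_subst_cong[of _ _ "\<lambda>w. pair (pfst w) (psnd (psnd w))"])
      ((intro pr_fun_intros)[1], simp)
  have 2: "Sig 1 (\<lambda>w. h (dec (length fs) (pfst w)) = pfst (psnd w))"
    by (rule Sig_subst_cong[OF comp.IH(1), of "\<lambda>w. pair (pfst (psnd w)) (pfst w)"])
      ((intro pr_fun_intros pr_fun_seqnth)[1], simp)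
  have "Sig 1 (\<lambda>z. \<exists>u. map (\<lambda>f. f (dec k (psnd z))) fs = dec (length fs) u \<and>
      h (dec (length fs) u) = pfst z)"
    using Sig_conj[OF 1 2] unfolding One_nat_def by (rule Sig_ex)
  moreover have "(\<exists>u. map (\<lambda>f. f (dec k (psnd z))) fs = dec (length fs) u \<and>
      h (dec (length fs) u) = pfst z) \<longleftrightarrow> h (map (\<lambda>f. f (dec k (psnd z))) fs) = pfst z" for z
    using dec_enc[of "map (\<lambda>f. f (dec k (psnd z))) fs"] by (metis length_map)
  ultimately show ?case by (simp del: Sig.simps)
next
  case (prec k b s)
  have b: "Sig 1 (\<lambda>w. b (dec k (psnd (psnd (psnd w)))) = seqnth (pfst w) 0)"
    by (rule Sig_subst_cong[OF prec.IH(1), of "\<lambda>w. pair (seqnth (pfst w) 0) (psnd (psnd (psnd w)))"])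
      ((intro pr_fun_intros pr_fun_seqnth)[1], simp)
  have s: "Sig 1 (\<lambda>v. s (dec (Suc (Suc k)) (pair (pfst v) (pair (seqnth (pfst (psnd v)) (pfst v))
      (psnd (psnd (psnd (psnd v))))))) = seqnth (pfst (psnd v)) (Suc (pfst v)))"
    by (rule Sig_subst_cong[OF prec.IH(2), of "\<lambda>v. pair (seqnth (pfst (psnd v)) (Suc (pfst v)))
      (pair (pfst v) (pair (seqnth (pfst (psnd v)) (pfst v)) (psnd (psnd (psnd (psnd v))))))"])
      ((intro pr_fun_intros pr_fun_seqnth)[1], simp)
  have s': "Sig 1 (\<lambda>w. \<forall>i<pfst (psnd (psnd w)). s (dec (Suc (Suc k)) (pair i (pair (seqnth (pfst w) i)
      (psnd (psnd (psnd w)))))) = seqnth (pfst w) (Suc i))"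
    using Sig_ball[OF s pr_fun_pfst[OF pr_fun_psnd[OF pr_fun_psnd[OF pr_fun_id]]]] by simp
  have e: "Sig 1 (\<lambda>w. seqnth (pfst w) (pfst (psnd (psnd w))) = pfst (psnd w))"
    by (intro Sig_pr_pred pr_fun_intros pr_fun_seqnth)
  \<comment> \<open>The sequence \<open>u\<close> records the values of the recursion up to its
    argument \<open>pfst (psnd z)\<close>.\<close>
  let ?R = "\<lambda>u z. b (dec k (psnd (psnd z))) = seqnth u 0 \<and>
    (\<forall>i<pfst (psnd z). s (dec (Suc (Suc k)) (pair i (pair (seqnth u i) (psnd (psnd z))))) = seqnth u (Suc i)) \<and>
    seqnth u (pfst (psnd z)) = pfst z"
  have "Sig 1 (\<lambda>z. \<exists>u. ?R u z)"
    using Sig_conj[OF b Sig_conj[OF s' e]] unfolding One_nat_def by (rule Sig_ex)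
  moreover have "(\<exists>u. ?R u z) \<longleftrightarrow> rec_nat (b (tl (dec (Suc k) (psnd z))))
      (\<lambda>m r. s (m # r # tl (dec (Suc k) (psnd z)))) (hd (dec (Suc k) (psnd z))) = pfst z" for z
  proof -
    let ?f = "rec_nat (b (dec k (psnd (psnd z)))) (\<lambda>m r. s (m # r # dec k (psnd (psnd z))))"
    have "seqnth u i = ?f i" if "?R u z" "i \<le> pfst (psnd z)" for u i
      using that(2)
    proof (induction i)
      case (Suc i)
      have "seqnth u (Suc i) = s (i # seqnth u i # dec k (psnd (psnd z)))"
        using that(1) Suc.prems by (simp add: Suc_le_eq)
      with Suc show ?case by simp
    qed (use that(1) in simp)
    moreover obtain u where "\<forall>i<Suc (pfst (psnd z)). seqnth u i = ?f i"
      using seqnth_exists[of "Suc (pfst (psnd z))" ?f] by blast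
    then have "?f (pfst (psnd z)) = pfst z \<Longrightarrow> ?R u z" by auto
    ultimately show ?thesis by (metis dec.simps(2) list.sel(1,3) order.refl)
  qed
  ultimately show ?case by (simp del: Sig.simps)
next
  case (minim k h)
  have 1: "Sig 1 (\<lambda>z. h (dec (Suc k) z) = 0)"
    by (rule Sig_subst_cong[OF minim.IH, of "\<lambda>z. pair 0 z"])
      ((intro pr_fun_intros pr_fun_seqnth)[1], simp)
  \<comment> \<open>A value differs from zero iff it equals some nonzero number, so this too is an
    existential statement about the graph.\<close>
  have "Sig 1 (\<lambda>z. pfst z \<noteq> 0 \<and> h (dec (Suc k) (psnd z)) = pfst z)"
    by (intro Sig_conj minim.IH) (intro Sig_pr_pred pr_fun_intros)
  then have "Sig 1 (\<lambda>z. \<exists>v. v \<noteq> 0 \<and> h (dec (Suc k) z) = v)"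
    unfolding One_nat_def by (rule Sig_ex)
  then have 2: "Sig 1 (\<lambda>z. h (dec (Suc k) z) \<noteq> 0)" by simp
  have 3: "Sig 1 (\<lambda>z. h (dec (Suc k) (pair (pfst z) (psnd (psnd z)))) \<noteq> 0)"
    by (rule Sig_subst[OF 2, of "\<lambda>z. pair (pfst z) (psnd (psnd z))"]) (intro pr_fun_intros)
  have "Sig 1 (\<lambda>z. h (dec (Suc k) z) = 0 \<and> (\<forall>y<pfst z. h (dec (Suc k) (pair y (psnd z))) \<noteq> 0))"
    using Sig_conj[OF 1 Sig_ball[OF 3 pr_fun_pfst[OF pr_fun_id]]] by simp
  moreover have "h (dec (Suc k) z) = 0 \<and> (\<forall>y<pfst z. h (dec (Suc k) (pair y (psnd z))) \<noteq> 0) \<longleftrightarrow>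
      (LEAST y. h (y # dec k (psnd z)) = 0) = pfst z" for z
  proof -
    obtain y where y: "h (y # dec k (psnd z)) = 0" using minim.hyps length_dec by metis
    have "P m \<and> (\<forall>y<m. \<not> P y) \<longleftrightarrow> (LEAST y. P y) = m" if "P y" for P and m y :: nat
      using that by (metis LeastI Least_le leD linorder_neqE_nat not_less_Least)
    from this[of "\<lambda>y. h (y # dec k (psnd z)) = 0", OF y] show ?thesis by simp
  qed
  ultimately show ?case by (simp del: Sig.simps)
next
  case (ext k f f')
  then show ?case by simp
qed

text \<open>A computable matrix is \<Sigma>_1 through its graph, and the quantifier gained in this
  way merges with the innermost one. This requires a quantifier to be present, so the translation
  starts at level one.\<close>

lemma Sig_arith_sigma: "arith_sigma (Suc n) k R \<Longrightarrow> Sig (Suc n) (\<lambda>x. R (dec k x))"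
proof (induction n arbitrary: k R)
  case 0
  then obtain S where S: "computable (Suc k) (\<lambda>ys. of_bool (\<not> S ys))"
    "\<And>xs. length xs = k \<Longrightarrow> R xs \<longleftrightarrow> (\<exists>y. S (y # xs))" by auto
  have "Sig 1 (\<lambda>z. of_bool (\<not> S (dec (Suc k) z)) = (0 :: nat))"
    by (rule Sig_subst_cong[OF computable_Sig[OF S(1)], of "\<lambda>z. pair 0 z"])
      ((intro pr_fun_intros pr_fun_seqnth)[1], simp)
  then have "Sig 1 (\<lambda>z. S (pfst z # dec k (psnd z)))" by (simp del: Sig.simps)
  then have "Sig 1 (\<lambda>x. \<exists>y. S (y # dec k x))"
    unfolding One_nat_def by (rule Sig_ex)
  then show ?case by (simp add: S(2) del: Sig.simps)
next
  case (Suc n)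
  then obtain S where S: "arith_sigma (Suc n) (Suc k) (\<lambda>ys. \<not> S ys)"
    "\<And>xs. length xs = k \<Longrightarrow> R xs \<longleftrightarrow> (\<exists>y. S (y # xs))" by auto
  have "Sig (Suc n) (\<lambda>z. \<not> S (dec (Suc k) z))" by (rule Suc.IH[OF S(1)])
  then have "Sig (Suc (Suc n)) (\<lambda>z. S (dec (Suc k) z))" by (rule Sig_Suc_not)
  then have "Sig (Suc (Suc n)) (\<lambda>z. S (pfst z # dec k (psnd z)))" by (simp del: Sig.simps)
  then have "Sig (Suc (Suc n)) (\<lambda>x. \<exists>y. S (y # dec k x))"
    by (rule Sig_ex)
  then show ?case by (simp add: S(2) del: Sig.simps)
qed

lemma prim_rec_over_computable: "prim_rec_over {} k f \<Longrightarrow> computable k f"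
proof (induction rule: prim_rec_over.induct)
  case succ
  show ?case by (rule computable.succ)
qed (auto intro: computable.intros)

text \<open>The code \<open>\<phi>\<close> of the argument list is arbitrary because each quantifier
  lengthens the list and extends the code by a pairing.\<close>

lemma arith_sigma_Sig:
  "Sig n P \<Longrightarrow> prim_rec_over {} k \<phi> \<Longrightarrow> arith_sigma n k (\<lambda>xs. P (\<phi> xs))"
proof (induction n arbitrary: P k \<phi>)
  case 0
  then show ?case
    using prim_rec_over_comp1[of "{}" "\<lambda>x. of_bool (P x)"] by (simp add: prim_rec_over_computable)
next
  case (Suc n)
  then obtain Q where Q: "Sig n (\<lambda>z. \<not> Q z)" "\<And>x. P x \<longleftrightarrow> (\<exists>y. Q (pair y x))" by auto
  have "map (\<lambda>i. xs ! i) [1..<Suc k] = tl xs" if "length xs = Suc k" for xs :: "nat list"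
    using that by (intro nth_equalityI) (simp_all add: nth_tl del: upt_Suc)
  then have "prim_rec_over {} (Suc k) (\<lambda>xs. \<phi> (tl xs))"
    using Suc.prems(2)
    by (intro prim_rec_over.ext[OF prim_rec_over_reindex[of "{}" "[1..<Suc k]" \<phi> "Suc k"]])
      (simp_all del: upt_Suc)
  moreover have "pr_fun2 {} pair"
    by (rule pr_fun2_pair)
  ultimately have "prim_rec_over {} (Suc k) (\<lambda>xs. pair (xs ! 0) (\<phi> (tl xs)))"
    by (intro prim_rec_over_comp2[of "{}" pair] prim_rec_over.proj) auto
  from Suc.IH[OF Q(1) this] show ?case
    by (auto simp: Q(2) intro!: exI[of _ "\<lambda>xs. Q (pair (xs ! 0) (\<phi> (tl xs)))"])
qed


section \<open>Linear orders of type omega times eta\<close>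

text \<open>
  The label of a point is its block, the maximal interval of type \<open>\<omega>\<close> that contains it.
\<close>

locale block_order =
  fixes R :: "'a \<Rightarrow> 'a \<Rightarrow> bool" and lab :: "'a \<Rightarrow> 'q::linorder"
  assumes antisym: "R x y \<Longrightarrow> R y x \<Longrightarrow> x = y"
    and total: "R x y \<or> R y x"
    and trans: "R x y \<Longrightarrow> R y z \<Longrightarrow> R x z"
    and lab_mono: "R x y \<Longrightarrow> lab x \<le> lab y"
    and finite_below: "finite {y. lab y = lab x \<and> R y x}"
    and infinite_block: "infinite {y. lab y = lab x}"
    and dense: "lab x < lab y \<Longrightarrow> \<exists>z. lab x < lab z \<and> lab z < lab y"
    and no_top: "\<exists>y. lab x < lab y"
    and no_bot: "\<exists>y. lab y < lab x"
begin

definition pos :: "'a \<Rightarrow> nat"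
  where "pos x = card {y. lab y = lab x \<and> R y x \<and> y \<noteq> x}"

lemma refl: "R x x"
  using total by blast

lemma lab_less: "lab x < lab y \<Longrightarrow> R x y"
  using total lab_mono by (metis leD)

lemma finite_below': "finite {y. lab y = lab x \<and> R y x \<and> y \<noteq> x}"
  by (rule finite_subset[OF _ finite_below[of x]]) auto

lemma pos_less: "lab x = lab y \<Longrightarrow> R x y \<Longrightarrow> x \<noteq> y \<Longrightarrow> pos x < pos y"
  unfolding pos_def using trans antisym refl
  by (intro psubset_card_mono finite_below') (auto 4 3)

lemma R_iff: "R x y \<longleftrightarrow> lab x < lab y \<or> lab x = lab y \<and> pos x \<le> pos y"
  using pos_less[of x y] pos_less[of y x] lab_mono[of x y] lab_less[of x y] total[of x y]
  by (metis leD le_less order.strict_iff_order)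

lemma lab_pos_inject: "lab x = lab y \<Longrightarrow> pos x = pos y \<Longrightarrow> x = y"
  using R_iff antisym by (metis order.refl)

text \<open>Distinct points of a block have distinct positions, so positions are unbounded in an
  infinite block. The \<open>Suc (pos y)\<close> points of the block up to \<open>y\<close> have
  positions in \<open>{..pos y}\<close> and hence attain them all.\<close>

lemma pos_surj: "\<exists>y. lab y = lab x \<and> pos y = i"
proof -
  let ?S = "{y. lab y = lab x}"
  have inj: "inj_on pos ?S" by (rule inj_onI) (auto intro: lab_pos_inject)
  have "infinite (pos ` ?S)" using infinite_block inj finite_imageD by blast
  then obtain y where y: "lab y = lab x" "i < pos y"
    unfolding finite_nat_set_iff_bounded_le by (auto simp: not_le)
  let ?T = "{z. lab z = lab y \<and> R z y}"
  have T: "?T = insert y {z. lab z = lab y \<and> R z y \<and> z \<noteq> y}" using refl by auto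
  have "card ?T = Suc (pos y)"
    unfolding T using finite_below'[of y] by (simp add: pos_def)
  moreover have "inj_on pos ?T" using inj y by (auto simp: inj_on_def)
  moreover have "pos ` ?T \<subseteq> {..pos y}" using R_iff by auto
  ultimately have "pos ` ?T = {..pos y}"
    by (intro card_subset_eq) (auto simp: card_image)
  with y have "i \<in> pos ` ?T" by auto
  then show ?thesis using y by auto
qed

text \<open>Between different blocks lies a whole further block, whereas intervals within a block
  are finite. This describes the blocks by the order alone, which bounds their complexity and shows
  that two labellings of one order have the same blocks.\<close>

lemma lab_less_iff_infinite: "lab x < lab y \<longleftrightarrow> R x y \<and> infinite {z. R x z \<and> R z y}"
proof
  assume *: "lab x < lab y"
  then obtain z where z: "lab x < lab z" "lab z < lab y" using dense by blast
  have "{w. lab w = lab z} \<subseteq> {z. R x z \<and> R z y}" using z by (auto intro: lab_less)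
  then have "infinite {z. R x z \<and> R z y}" using infinite_block infinite_super by blast
  with * show "R x y \<and> infinite {z. R x z \<and> R z y}" by (auto intro: lab_less)
next
  assume *: "R x y \<and> infinite {z. R x z \<and> R z y}"
  have "lab x \<noteq> lab y"
  proof
    assume eq: "lab x = lab y"
    have "{z. R x z \<and> R z y} \<subseteq> {z. lab z = lab y \<and> R z y}"
      using lab_mono[of x] lab_mono[of _ y] unfolding eq by (auto intro: order.antisym)
    then show False using * finite_below finite_subset by blast
  qed
  then show "lab x < lab y" using * lab_mono by force
qed

lemma between:
  assumes "finite L" "finite U" "\<And>l u. l \<in> L \<Longrightarrow> u \<in> U \<Longrightarrow> lab l < lab u"
  shows "\<exists>y. (\<forall>l\<in>L. lab l < lab y) \<and> (\<forall>u\<in>U. lab y < lab u)"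
proof -
  have max: "\<exists>m\<in>L. \<forall>l\<in>L. lab l \<le> lab m" if "L \<noteq> {}"
    using Max_in[of "lab ` L"] Max_ge[of "lab ` L"] that assms(1) by fastforce
  have min: "\<exists>m\<in>U. \<forall>u\<in>U. lab m \<le> lab u" if "U \<noteq> {}"
    using Min_in[of "lab ` U"] Min_le[of "lab ` U"] that assms(2) by fastforce
  consider "L = {}" "U = {}" | "L = {}" "U \<noteq> {}" | "L \<noteq> {}" "U = {}" | "L \<noteq> {}" "U \<noteq> {}"
    by blast
  then show ?thesis
  proof cases
    case 2
    then show ?thesis using min no_bot by (metis empty_iff order.strict_trans2)
  next
    case 3
    then show ?thesis using max no_top by (metis empty_iff order.strict_trans1)
  next
    case 4
    then show ?thesis using max min dense assms(3) by (metis order.strict_trans1 order.strict_trans2)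
  qed auto
qed

end

section \<open>Transport of blocks along isomorphisms\<close>

lemma isomorphism_inv: "isomorphism A B f \<Longrightarrow> isomorphism B A (inv f)"
  unfolding isomorphism_def by (metis bij_imp_bij_inv bij_inv_eq_iff)

lemma isomorphism_comp: "isomorphism A B f \<Longrightarrow> isomorphism B C g \<Longrightarrow> isomorphism A C (g \<circ> f)"
  unfolding isomorphism_def by (auto intro: bij_comp)

lemma block_order_isomorphism:
  assumes "isomorphism A B f" "block_order B lab"
  shows "block_order A (lab \<circ> f)"
proof -
  interpret B: block_order B lab by fact
  have bij: "bij f" and iso: "A x y \<longleftrightarrow> B (f x) (f y)" for x y
    using assms(1) by (auto simp: isomorphism_def)
  have inj: "f x = f y \<Longrightarrow> x = y" for x y using bij by (simp add: bij_def inj_eq)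
  have surj: "\<exists>x. y = f x" for y using bij by (metis bij_pointE)
  have fin: "finite {y. P (f y)} \<longleftrightarrow> finite {y. P y}" for P
  proof -
    have "f ` {y. P (f y)} = {y. P y}" using surj_image_vimage_eq[of f "Collect P"] bij by (simp add: bij_def vimage_def)
    then show ?thesis using bij_betw_finite[OF bij_betw_subset[OF bij]] by blast
  qed
  show ?thesis
  proof
    show "A x y \<Longrightarrow> A y x \<Longrightarrow> x = y" for x y using B.antisym inj iso by blast
    show "A x y \<or> A y x" for x y using B.total iso by blast
    show "A x y \<Longrightarrow> A y z \<Longrightarrow> A x z" for x y z using B.trans iso by blast
    show "A x y \<Longrightarrow> (lab \<circ> f) x \<le> (lab \<circ> f) y" for x y using B.lab_mono iso by simp
    show "finite {y. (lab \<circ> f) y = (lab \<circ> f) x \<and> A y x}" for x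
      using B.finite_below[of "f x"] fin[of "\<lambda>y. lab y = lab (f x) \<and> B y (f x)"] by (simp add: iso)
    show "infinite {y. (lab \<circ> f) y = (lab \<circ> f) x}" for x
      using B.infinite_block[of "f x"] fin[of "\<lambda>y. lab y = lab (f x)"] by simp
    show "(lab \<circ> f) x < (lab \<circ> f) y \<Longrightarrow> \<exists>z. (lab \<circ> f) x < (lab \<circ> f) z \<and> (lab \<circ> f) z < (lab \<circ> f) y" for x y
      using B.dense[of "f x" "f y"] surj by (metis comp_apply)
    show "\<exists>y. (lab \<circ> f) x < (lab \<circ> f) y" "\<exists>y. (lab \<circ> f) y < (lab \<circ> f) x" for x
      using B.no_top[of "f x"] B.no_bot[of "f x"] surj by (metis comp_apply)+
  qed
qed

lemma block_order_omega_eta: "block_order omega_eta snd"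
proof
  show "finite {y. snd y = snd x \<and> omega_eta y x}" for x
    by (rule finite_subset[of _ "{..fst x} \<times> {snd x}"]) (auto simp: omega_eta_def order_times_def)
  show "infinite {y :: nat \<times> rat. snd y = snd x}" for x :: "nat \<times> rat"
  proof
    assume "finite {y :: nat \<times> rat. snd y = snd x}"
    then have "finite (fst ` {y :: nat \<times> rat. snd y = snd x})" by (rule finite_imageI)
    moreover have "fst ` {y :: nat \<times> rat. snd y = snd x} = UNIV"
      by (auto simp: image_iff)
    ultimately show False by simp
  qed
  show "\<exists>z :: nat \<times> rat. snd x < snd z \<and> snd z < snd y" if "snd x < snd y" for x y :: "nat \<times> rat"
    using Orderings.dense[OF that] by auto
  show "\<exists>y :: nat \<times> rat. snd x < snd y" "\<exists>y :: nat \<times> rat. snd y < snd x" for x :: "nat \<times> rat"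
    using gt_ex[of "snd x"] lt_ex[of "snd x"] by auto
qed (auto simp: omega_eta_def order_times_def prod_eq_iff)


section \<open>Back and forth\<close>

locale two_block_orders = A: block_order A la + B: block_order B lb
  for A B :: "nat \<Rightarrow> nat \<Rightarrow> bool" and la :: "nat \<Rightarrow> 'q::linorder" and lb :: "nat \<Rightarrow> 'r::linorder"
begin

text \<open>By linearity, agreement on both strict comparisons includes agreement on lying in the
  same block.\<close>

definition ok :: "nat \<Rightarrow> nat \<Rightarrow> nat \<Rightarrow> nat \<Rightarrow> bool"
  where "ok a b x y \<longleftrightarrow> (la a < la x \<longleftrightarrow> lb b < lb y) \<and> (la x < la a \<longleftrightarrow> lb y < lb b)"

definition good :: "(nat \<times> nat) set \<Rightarrow> nat \<Rightarrow> nat \<Rightarrow> bool"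
  where "good P x y \<longleftrightarrow> A.pos x = B.pos y \<and> (\<forall>(a, b)\<in>P. ok a b x y)"

lemma ok_sym: "ok a b x y \<longleftrightarrow> ok x y a b"
  by (auto simp: ok_def)

text \<open>If the block of \<open>x\<close> is already matched, its partner block is forced.
  Otherwise \<open>B.between\<close> supplies a block in the corresponding gap.\<close>

lemma good_extend:
  assumes "finite P" "\<forall>(a, b)\<in>P. good P a b"
  shows "\<exists>y. good P x y"
proof -
  have ok: "ok a b a' b'" if "(a, b) \<in> P" "(a', b') \<in> P" for a b a' b'
    using assms(2) that by (fastforce simp: good_def)
  have "\<exists>y. \<forall>(a, b)\<in>P. ok a b x y"
  proof (cases "\<exists>a b. (a, b) \<in> P \<and> la a = la x")
    case True
    then obtain a b where "(a, b) \<in> P" "la a = la x" by blast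
    then have "\<forall>(a', b')\<in>P. ok a' b' x b" using ok unfolding ok_def by force
    then show ?thesis by blast
  next
    case False
    let ?L = "snd ` {p \<in> P. la (fst p) < la x}" and ?U = "snd ` {p \<in> P. la x < la (fst p)}"
    have "\<exists>y. (\<forall>l\<in>?L. lb l < lb y) \<and> (\<forall>u\<in>?U. lb y < lb u)"
    proof (rule B.between)
      fix l u assume "l \<in> ?L" "u \<in> ?U"
      then obtain a a' where *: "(a, l) \<in> P" "la a < la x" "(a', u) \<in> P" "la x < la a'" by auto
      then have "la a < la a'" by (blast intro: order.strict_trans)
      then show "lb l < lb u" using ok[OF *(1,3)] by (simp add: ok_def)
    qed (use assms(1) in auto)
    then obtain y where y: "\<And>a b. (a, b) \<in> P \<Longrightarrow> la a < la x \<Longrightarrow> lb b < lb y"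
      "\<And>a b. (a, b) \<in> P \<Longrightarrow> la x < la a \<Longrightarrow> lb y < lb b" by force
    have "ok a b x y" if "(a, b) \<in> P" for a b
      using y[OF that] that False unfolding ok_def by (metis less_asym linorder_neqE)
    then show ?thesis by blast
  qed
  then obtain y0 where y0: "\<forall>(a, b)\<in>P. ok a b x y0" by blast
  \<comment> \<open>\<open>ok\<close> depends only on blocks, so \<open>y0\<close> may be replaced
    by the point of its block at the position of \<open>x\<close>.\<close>
  obtain y where "lb y = lb y0" "B.pos y = A.pos x" using B.pos_surj by metis
  with y0 have "good P x y" by (auto simp: good_def ok_def)
  then show ?thesis by blast
qed

end

text \<open>With the two orders exchanged, the back steps become instances of the forth
  steps.\<close>

sublocale two_block_orders \<subseteq> sym: two_block_orders B A lb la ..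

context two_block_orders
begin

lemma sym_good: "sym.good (prod.swap ` P) y x \<longleftrightarrow> good P x y"
  by (auto simp: good_def sym.good_def ok_def sym.ok_def)

lemma good_extend':
  assumes "finite P" "\<forall>(a, b)\<in>P. good P a b"
  shows "\<exists>x. good P x y"
  using sym.good_extend[of "prod.swap ` P" y] assms by (auto simp: sym_good)

text \<open>Points that are already matched need no separate case: \<open>good\<close> fixes the
  block and the position of the partner of such a point, so the same partner is found again. Taking
  least candidates keeps the construction definable.\<close>

definition step :: "nat \<Rightarrow> (nat \<times> nat) set \<Rightarrow> nat \<times> nat"
  where "step s P =
    (if even s then (s div 2, LEAST y. good P (s div 2) y) else (LEAST x. good P x (s div 2), s div 2))"

primrec hist :: "nat \<Rightarrow> (nat \<times> nat) set" where
  "hist 0 = {}"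
| "hist (Suc s) = insert (step s (hist s)) (hist s)"

definition stage :: "nat \<Rightarrow> nat \<times> nat"
  where "stage s = step s (hist s)"

definition forth :: "nat \<Rightarrow> nat"
  where "forth x = snd (stage (2 * x))"

lemma hist_eq: "hist s = stage ` {..<s}"
  by (induction s) (auto simp: stage_def lessThan_Suc)

lemma stage_fst: "fst (stage (2 * x)) = x"
  and stage_snd: "snd (stage (Suc (2 * x))) = x"
  by (auto simp: stage_def step_def)

lemma hist_good: "(\<forall>(a, b)\<in>hist s. good (hist s) a b) \<and> good (hist s) (fst (stage s)) (snd (stage s))"
proof (induction s)
  case 0
  have "\<exists>y. good {} 0 y" using good_extend[of "{}" 0] by simp
  from LeastI_ex[OF this] show ?case by (simp add: stage_def step_def)
next
  case (Suc s)
  obtain a b where ab: "stage s = (a, b)" by fastforce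
  have H: "hist (Suc s) = insert (a, b) (hist s)" using ab by (simp add: stage_def)
  have *: "\<forall>(x, y)\<in>hist (Suc s). good (hist (Suc s)) x y"
    using Suc ab ok_sym unfolding H by (fastforce simp: good_def ok_def)
  have fin: "finite (hist (Suc s))" by (simp add: hist_eq)
  have "good (hist (Suc s)) (fst (stage (Suc s))) (snd (stage (Suc s)))"
    using LeastI_ex[OF good_extend[OF fin *, of "Suc s div 2"]]
      LeastI_ex[OF good_extend'[OF fin *, of "Suc s div 2"]]
    unfolding stage_def step_def by (simp only: fst_conv snd_conv split: if_split) blast
  with * show ?case by blast
qed

lemma stage_ok: "ok (fst (stage s)) (snd (stage s)) (fst (stage t)) (snd (stage t))"
  and stage_pos: "A.pos (fst (stage s)) = B.pos (snd (stage s))"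
proof -
  have "ok (fst (stage s)) (snd (stage s)) (fst (stage t)) (snd (stage t))" if "s < t" for s t
    using hist_good[of t] that by (force simp: good_def hist_eq)
  then show "ok (fst (stage s)) (snd (stage s)) (fst (stage t)) (snd (stage t))"
    using ok_sym by (cases s t rule: linorder_cases) (auto simp: ok_def)
  show "A.pos (fst (stage s)) = B.pos (snd (stage s))"
    using hist_good[of s] by (simp add: good_def)
qed

lemma stage_unique: "fst (stage s) = fst (stage t) \<longleftrightarrow> snd (stage s) = snd (stage t)"
  using stage_ok[of s t] stage_pos[of s] stage_pos[of t] unfolding ok_def
  by (metis A.lab_pos_inject B.lab_pos_inject less_irrefl linorder_neqE)

lemma forth_isomorphism: "isomorphism A B forth"
proof -
  have "inj forth"
    by (rule injI) (metis forth_def stage_fst stage_unique)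
  moreover have "\<exists>x. y = forth x" for y
    using stage_unique[of "2 * fst (stage (Suc (2 * y)))" "Suc (2 * y)"]
    by (metis forth_def stage_fst stage_snd)
  ultimately have "bij forth" by (auto simp: bij_def)
  moreover have "A x y \<longleftrightarrow> B (forth x) (forth y)" for x y
  proof -
    have *: "la x < la y \<longleftrightarrow> lb (forth x) < lb (forth y)" "la y < la x \<longleftrightarrow> lb (forth y) < lb (forth x)"
      "A.pos x = B.pos (forth x)" "A.pos y = B.pos (forth y)"
      using stage_ok[of "2 * x" "2 * y"] stage_pos[of "2 * x"] stage_pos[of "2 * y"]
      by (simp_all add: ok_def forth_def stage_fst)
    then have "la x = la y \<longleftrightarrow> lb (forth x) = lb (forth y)" by (metis less_irrefl linorder_neqE)
    with * show ?thesis by (simp add: A.R_iff B.R_iff)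
  qed
  ultimately show ?thesis by (simp add: isomorphism_def)
qed

section \<open>Coding the back-and-forth construction by sequences\<close>

definition good_code :: "nat \<Rightarrow> nat \<Rightarrow> nat \<Rightarrow> nat \<Rightarrow> bool"
  where "good_code z s x y \<longleftrightarrow>
    A.pos x = B.pos y \<and> (\<forall>t<s. ok (pfst (seqnth z t)) (psnd (seqnth z t)) x y)"

text \<open>If the earlier entries of \<open>z\<close> are correct, this says that entry
  \<open>s\<close> is the one chosen by the construction. Parity and minimality are expressed with
  bounded quantifiers only, so that the predicate stays \<Delta>_3.\<close>

definition valid :: "nat \<Rightarrow> nat \<Rightarrow> bool"
  where "valid z s \<longleftrightarrow> (let a = pfst (seqnth z s); b = psnd (seqnth z s) in good_code z s a b \<and>
    (s = 2 * a \<and> (\<forall>y<b. \<not> good_code z s a y) \<or> s = Suc (2 * b) \<and> (\<forall>x<a. \<not> good_code z s x b)))"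

lemma good_code_iff:
  assumes "\<forall>t<s. seqnth z t = pair (fst (stage t)) (snd (stage t))"
  shows "good_code z s x y \<longleftrightarrow> good (hist s) x y"
  using assms by (auto simp: good_code_def good_def hist_eq split_beta)

lemma valid_iff:
  assumes "\<forall>t<s. seqnth z t = pair (fst (stage t)) (snd (stage t))"
  shows "valid z s \<longleftrightarrow> seqnth z s = pair (fst (stage s)) (snd (stage s))"
proof -
  obtain a b where z: "seqnth z s = pair a b" by (metis pair_pfst_psnd)
  have P: "P m \<and> (\<forall>y<m. \<not> P y) \<longleftrightarrow> (LEAST y. P y) = m" if "P y" for P and m y :: nat
    using that by (metis LeastI Least_le leD linorder_neqE_nat not_less_Least)
  obtain x where x: "s = 2 * x \<or> s = Suc (2 * x)" by (metis odd_Suc_div_two evenE oddE Suc_eq_plus1)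
  have fin: "finite (hist s)" by (simp add: hist_eq)
  obtain u v where uv: "good (hist s) x u" "good (hist s) v x"
    using good_extend[OF fin] good_extend'[OF fin] hist_good[of s] by blast
  have 1: "good (hist s) x m \<and> (\<forall>y<m. \<not> good (hist s) x y) \<longleftrightarrow> (LEAST y. good (hist s) x y) = m" for m
    using P[of "good (hist s) x", OF uv(1)] .
  have 2: "good (hist s) m x \<and> (\<forall>y<m. \<not> good (hist s) y x) \<longleftrightarrow> (LEAST y. good (hist s) y x) = m" for m
    using P[of "\<lambda>y. good (hist s) y x", OF uv(2)] .
  have V: "valid z s \<longleftrightarrow> good (hist s) a b \<and> (s = 2 * a \<and> (\<forall>y<b. \<not> good (hist s) a y) \<or>
      s = Suc (2 * b) \<and> (\<forall>x<a. \<not> good (hist s) x b))"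
    by (simp add: valid_def z good_code_iff[OF assms] Let_def)
  from x show ?thesis
  proof
    assume s: "s = 2 * x"
    have "s = 2 * a \<longleftrightarrow> x = a" "s \<noteq> Suc (2 * b)" using s by presburger+
    then have "valid z s \<longleftrightarrow> x = a \<and> good (hist s) x b \<and> (\<forall>y<b. \<not> good (hist s) x y)"
      unfolding V by blast
    then show ?thesis unfolding 1 z using s by (auto simp: stage_def step_def)
  next
    assume s: "s = Suc (2 * x)"
    have "s = Suc (2 * b) \<longleftrightarrow> x = b" "s \<noteq> 2 * a" using s by presburger+
    then have "valid z s \<longleftrightarrow> x = b \<and> good (hist s) a x \<and> (\<forall>y<a. \<not> good (hist s) y x)"
      unfolding V by blast
    then show ?thesis unfolding 2 z using s by (auto simp: stage_def step_def)
  qed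
qed

text \<open>By induction, a sequence valid at all stages up to \<open>2 * x\<close> agrees with the
  construction, so one existential quantifier over codes describes the graph.\<close>

lemma forth_graph: "forth x = y \<longleftrightarrow> (\<exists>z. (\<forall>s<Suc (2 * x). valid z s) \<and> psnd (seqnth z (2 * x)) = y)"
proof -
  have *: "seqnth z s = pair (fst (stage s)) (snd (stage s))"
    if "\<forall>s<n. valid z s" "s < n" for z s n
    using that(2)
  proof (induction s rule: less_induct)
    case (less s)
    then show ?case using that(1) valid_iff by (metis less_trans)
  qed
  obtain z where z: "\<forall>s<Suc (2 * x). seqnth z s = pair (fst (stage s)) (snd (stage s))"
    using seqnth_exists[of "Suc (2 * x)" "\<lambda>s. pair (fst (stage s)) (snd (stage s))"] by blast
  then have "\<forall>s<Suc (2 * x). valid z s" using valid_iff by (metis less_trans)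
  with z * show ?thesis unfolding forth_def by (metis lessI psnd_pair)
qed

end


section \<open>Complexity of the isomorphism\<close>

text \<open>The \<Delta>_3 predicates are closed under Boolean operations and bounded quantifiers.
  In the descriptions of positions and of the isomorphism only the final quantifiers over witnesses
  lead to \<Sigma>_3.\<close>

definition Del :: "(nat \<Rightarrow> bool) \<Rightarrow> bool"
  where "Del P \<longleftrightarrow> Sig 3 P \<and> Sig 3 (\<lambda>x. \<not> P x)"

lemma Del_pr_pred: "pr_pred {} P \<Longrightarrow> Del P"
  unfolding Del_def by (intro conjI Sig_pr_pred pr_pred_not)

lemma Del_not: "Del P \<Longrightarrow> Del (\<lambda>x. \<not> P x)"
  unfolding Del_def by simp

lemma Del_conj: "Del P \<Longrightarrow> Del Q \<Longrightarrow> Del (\<lambda>x. P x \<and> Q x)"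
  unfolding Del_def de_Morgan_conj by (intro conjI Sig_conj Sig_disj) auto

lemma Del_disj: "Del P \<Longrightarrow> Del Q \<Longrightarrow> Del (\<lambda>x. P x \<or> Q x)"
  unfolding Del_def de_Morgan_disj by (intro conjI Sig_conj Sig_disj) auto

lemma Del_imp: "Del P \<Longrightarrow> Del Q \<Longrightarrow> Del (\<lambda>x. P x \<longrightarrow> Q x)"
  unfolding imp_conv_disj by (intro Del_disj Del_not)

lemma Del_iff: "Del P \<Longrightarrow> Del Q \<Longrightarrow> Del (\<lambda>x. P x \<longleftrightarrow> Q x)"
  unfolding iff_conv_conj_imp by (intro Del_conj Del_imp)

lemma Del_ball:
  assumes "Del (\<lambda>z. P (pfst z) (psnd z))" "pr_fun {} t"
  shows "Del (\<lambda>x. \<forall>i<t x. P i x)"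
  using Sig_ball[of 3 "\<lambda>z. P (pfst z) (psnd z)" t] Sig_bex[of 3 "\<lambda>z. \<not> P (pfst z) (psnd z)" t] assms
  by (simp add: Del_def)

lemma Sig_Suc_neg: "Sig n P \<Longrightarrow> Sig (Suc n) (\<lambda>x. \<not> P x)"
  using Sig_Suc_not[of n "\<lambda>x. \<not> P x"] by (simp del: Sig.simps)

lemma Sig2_Del: "Sig 2 (\<lambda>x. \<not> P x) \<Longrightarrow> Del P"
  unfolding Del_def using Sig_Suc_not[of 2 P] Sig_Suc[of 2 "\<lambda>x. \<not> P x"] by (simp del: Sig.simps)

lemma Del_subst: "Del P \<Longrightarrow> pr_fun {} f \<Longrightarrow> Del (\<lambda>x. P (f x))"
  unfolding Del_def by (intro conjI; elim conjE; rule Sig_subst)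

text \<open>A total function misses a value at an argument iff it has some other value there, so the
  complement of the graph is \<Sigma>_3 as well.\<close>

lemma Sig_graph_Del:
  assumes "Sig 3 (\<lambda>z. f (pfst z) = psnd z)"
  shows "Del (\<lambda>z. f (pfst z) = psnd z)"
proof -
  have *: "Sig 3 (\<lambda>z. f (pfst (psnd z)) = pfst z)"
    by (rule Sig_subst_cong[OF assms, of "\<lambda>z. pair (pfst (psnd z)) (pfst z)"])
      ((intro pr_fun_intros)[1], simp)
  have "Sig 3 (\<lambda>z. \<exists>y. f (pfst z) = y \<and> y \<noteq> psnd z)"
    unfolding numeral_3_eq_3 by (rule Sig_ex, rule Sig_conj, rule *[unfolded numeral_3_eq_3])
      (intro Sig_pr_pred pr_fun_intros)
  then show ?thesis using assms unfolding Del_def by simp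
qed

lemma Sig_graph_delta_functions:
  assumes "Sig 3 (\<lambda>z. f (pfst z) = psnd z)"
  shows "f \<in> delta_functions 3"
proof -
  have pair: "prim_rec_over {} 2 (\<lambda>xs. pair (xs ! 0) (xs ! 1))"
    by (intro prim_rec_over_comp2[OF pr_fun2_pair] prim_rec_over.proj) auto
  have "Sig 3 (\<lambda>z. f (pfst z) = psnd z)" "Sig 3 (\<lambda>z. \<not> f (pfst z) = psnd z)"
    using Sig_graph_Del[OF assms] by (auto simp: Del_def)
  from this[THEN arith_sigma_Sig, OF pair] show ?thesis
    by (simp add: delta_functions_def arith_delta_def arith_pi_def del: arith_sigma.simps)
qed

section \<open>Complexity of blocks and positions in a punctual order\<close>

locale pr_block_order = block_order R lab
  for R :: "nat \<Rightarrow> nat \<Rightarrow> bool" and lab :: "nat \<Rightarrow> 'q::linorder" +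
  assumes pr: "pr_pred {} (\<lambda>z. R (pfst z) (psnd z))"
begin

lemma pr_R: "pr_fun {} a \<Longrightarrow> pr_fun {} b \<Longrightarrow> pr_pred {} (\<lambda>x. R (a x) (b x))"
  using pr_fun_comp[OF pr pr_fun_pair] by simp

lemma lab_less_iff_unbounded: "lab x < lab y \<longleftrightarrow> R x y \<and> (\<forall>c. \<exists>w. c \<le> w \<and> R x w \<and> R w y)"
  unfolding lab_less_iff_infinite finite_nat_set_iff_bounded by (auto simp: not_less)

text \<open>That an interval is infinite means that it contains arbitrarily large numbers, a \<Pi>_2
  condition for a primitive recursive order.\<close>

lemma Sig_lab_less: "Sig 2 (\<lambda>z. \<not> lab (pfst z) < lab (psnd z))"
proof -
  have "Sig (Suc 0) (\<lambda>u. \<exists>w. pfst u \<le> w \<and> R (pfst (psnd u)) w \<and> R w (psnd (psnd u)))"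
    by (rule Sig_ex) (intro Sig_pr_pred pr_fun_intros pr_R)
  then have "Sig (Suc (Suc 0)) (\<lambda>u. \<not> (\<exists>w. pfst u \<le> w \<and> R (pfst (psnd u)) w \<and> R w (psnd (psnd u))))"
    by (rule Sig_Suc_neg)
  then have "Sig (Suc (Suc 0)) (\<lambda>z. \<exists>c. \<not> (\<exists>w. c \<le> w \<and> R (pfst z) w \<and> R w (psnd z)))"
    by (rule Sig_ex)
  moreover have "Sig (Suc (Suc 0)) (\<lambda>z. \<not> R (pfst z) (psnd z))"
    by (intro Sig_pr_pred pr_fun_intros pr_R)
  ultimately have "Sig (Suc (Suc 0)) (\<lambda>z. (\<not> R (pfst z) (psnd z)) \<or>
      (\<exists>c. \<not> (\<exists>w. c \<le> w \<and> R (pfst z) w \<and> R w (psnd z))))"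
    by (intro Sig_disj)
  then show ?thesis
    unfolding lab_less_iff_unbounded numeral_2_eq_2 de_Morgan_conj not_all .
qed

lemma Del_lab_less: "pr_fun {} a \<Longrightarrow> pr_fun {} b \<Longrightarrow> Del (\<lambda>x. lab (a x) < lab (b x))"
  using Del_subst[OF Sig2_Del[OF Sig_lab_less] pr_fun_pair] by simp

definition first :: "nat \<Rightarrow> bool"
  where "first f \<longleftrightarrow> (\<forall>y. R y f \<and> y \<noteq> f \<longrightarrow> lab y < lab f)"

lemma Del_first: "Del first"
proof (rule Sig2_Del)
  have 1: "Sig 2 (\<lambda>z. \<not> lab (pfst z) < lab (psnd z))" by (rule Sig_lab_less)
  have 2: "Sig 2 (\<lambda>z. R (pfst z) (psnd z) \<and> pfst z \<noteq> psnd z)"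
    by (intro Sig_pr_pred pr_fun_intros pr_R)
  have "Sig 2 (\<lambda>x. \<exists>y. (R y x \<and> y \<noteq> x) \<and> \<not> lab y < lab x)"
    using Sig_conj[OF 2 1] unfolding numeral_2_eq_2 by (rule Sig_ex)
  then show "Sig 2 (\<lambda>x. \<not> first x)" by (simp add: first_def del: Sig.simps)
qed

lemma pos_eq_card_interval:
  assumes "first f" "lab f = lab x"
  shows "pos x = card {w. R f w \<and> R w x \<and> w \<noteq> x}"
proof -
  have "lab w = lab x" if "R f w" "R w x" for w
    using lab_mono[OF that(1)] lab_mono[OF that(2)] assms(2) by simp
  moreover have "R f w" if "lab w = lab x" for w
    using assms that total[of f w] refl unfolding first_def by force
  ultimately have "{w. R f w \<and> R w x \<and> w \<noteq> x} = {w. lab w = lab x \<and> R w x \<and> w \<noteq> x}"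
    by blast
  then show ?thesis by (simp add: pos_def)
qed

text \<open>The witnesses are the first point \<open>f\<close> of the block of \<open>x\<close> and
  a strict bound \<open>b\<close> on the finitely many numbers in the interval from \<open>f\<close>
  to \<open>x\<close>. The position is then a bounded count.\<close>

lemma pos_graph: "pos x = n \<longleftrightarrow> (\<exists>f b. first f \<and> R f x \<and> \<not> lab f < lab x \<and>
    \<not> (\<exists>w. \<not> (R f w \<and> R w x \<longrightarrow> w < b)) \<and> n = (\<Sum>w<b. of_bool (R f w \<and> R w x \<and> w \<noteq> x)))"
    (is "_ \<longleftrightarrow> (\<exists>f b. ?P f b)")
proof -
  have sum: "(\<Sum>w<b. of_bool (R f w \<and> R w x \<and> w \<noteq> x)) = pos x"
    if "first f" "lab f = lab x" "\<And>w. R f w \<Longrightarrow> R w x \<Longrightarrow> w < b" for f b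
  proof -
    have "{..<b} \<inter> {w. R f w \<and> R w x \<and> w \<noteq> x} = {w. R f w \<and> R w x \<and> w \<noteq> x}"
      using that(3) by auto
    then show ?thesis using pos_eq_card_interval[OF that(1,2)] by (simp add: sum_of_bool_eq)
  qed
  have eq: "lab f = lab x" if "R f x" "\<not> lab f < lab x" for f
    using that lab_mono by (meson le_less)
  obtain f where f: "lab f = lab x" "pos f = 0" using pos_surj by blast
  have "first f" unfolding first_def
    using f pos_less lab_mono by (metis le_less not_less_zero)
  moreover have "R f x" using f R_iff by simp
  moreover have "finite {w. R f w \<and> R w x}"
    using lab_less_iff_infinite[of f x] f(1) \<open>R f x\<close> by simp
  then obtain b where "\<And>w. R f w \<Longrightarrow> R w x \<Longrightarrow> w < b"
    unfolding finite_nat_set_iff_bounded by auto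
  ultimately have "\<exists>f b. ?P f b" if "pos x = n"
    using sum[of f b] f(1) that by (intro exI[of _ f] exI[of _ b]) auto
  moreover have "pos x = n" if "?P f b" for f b
    using sum[of f b] eq[of f] that by auto
  ultimately show ?thesis by blast
qed

lemma Sig_pos_graph: "Sig 3 (\<lambda>z. pos (pfst z) = psnd z)"
proof -
  have "Sig (Suc 0) (\<lambda>u. \<exists>w. \<not> (R (pfst (psnd u)) w \<and> R w (pfst (psnd (psnd u))) \<longrightarrow> w < pfst u))"
    by (rule Sig_ex) (intro Sig_pr_pred pr_fun_intros pr_R)
  then have "Sig 2 (\<lambda>u. \<exists>w. \<not> (R (pfst (psnd u)) w \<and> R w (pfst (psnd (psnd u))) \<longrightarrow> w < pfst u))"
    by (rule Sig_mono) simp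
  then have *: "Del (\<lambda>u. \<not> (\<exists>w. \<not> (R (pfst (psnd u)) w \<and> R w (pfst (psnd (psnd u))) \<longrightarrow> w < pfst u)))"
    by (intro Sig2_Del) (simp only: not_not)
  have f: "Del (\<lambda>u. first (pfst (psnd u)))"
    by (rule Del_subst[OF Del_first]) (intro pr_fun_intros)
  have s: "pr_fun {} (\<lambda>u. \<Sum>w<pfst u. of_bool (R (pfst (psnd u)) w \<and>
      R w (pfst (psnd (psnd u))) \<and> w \<noteq> pfst (psnd (psnd u))))"
    by (intro pr_fun_intros pr_R)
  have "Del (\<lambda>u. first (pfst (psnd u)) \<and> R (pfst (psnd u)) (pfst (psnd (psnd u))) \<and>
      \<not> lab (pfst (psnd u)) < lab (pfst (psnd (psnd u))) \<and>
      \<not> (\<exists>w. \<not> (R (pfst (psnd u)) w \<and> R w (pfst (psnd (psnd u))) \<longrightarrow> w < pfst u)) \<and>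
      psnd (psnd (psnd u)) = (\<Sum>w<pfst u. of_bool (R (pfst (psnd u)) w \<and>
      R w (pfst (psnd (psnd u))) \<and> w \<noteq> pfst (psnd (psnd u)))))"
    by (intro Del_conj f Del_not[OF Del_lab_less] Del_pr_pred[OF pr_R] * Del_pr_pred[OF pr_pred_eq] s) 
      (intro pr_fun_intros)+
  then show ?thesis
    unfolding pos_graph numeral_3_eq_3 Del_def by (intro Sig_ex) simp
qed

end

section \<open>Complexity of the back-and-forth isomorphism\<close>

locale two_pr_block_orders = A: pr_block_order A la + B: pr_block_order B lb
  for A B :: "nat \<Rightarrow> nat \<Rightarrow> bool" and la :: "nat \<Rightarrow> 'q::linorder" and lb :: "nat \<Rightarrow> 'r::linorder"

sublocale two_pr_block_orders \<subseteq> two_block_orders A B la lb ..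

context two_pr_block_orders
begin

text \<open>Equality and inequality are both stated by guessing the two positions and comparing
  them; as the graphs of the positions are \<Sigma>_3, so are both statements.\<close>

lemma Del_pos_eq:
  assumes "pr_fun {} a" "pr_fun {} b"
  shows "Del (\<lambda>x. A.pos (a x) = B.pos (b x))"
proof -
  have A: "Sig 3 (\<lambda>z. A.pos (a (psnd (psnd z))) = pfst (psnd z))"
    by (rule Sig_subst_cong[OF A.Sig_pos_graph, of "\<lambda>z. pair (a (psnd (psnd z))) (pfst (psnd z))"])
      ((intro pr_fun_intros pr_fun_comp[OF assms(1)])[1], simp)
  have B: "Sig 3 (\<lambda>z. B.pos (b (psnd (psnd z))) = pfst z)"
    by (rule Sig_subst_cong[OF B.Sig_pos_graph, of "\<lambda>z. pair (b (psnd (psnd z))) (pfst z)"])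
      ((intro pr_fun_intros pr_fun_comp[OF assms(2)])[1], simp)
  have "Sig 3 (\<lambda>x. \<exists>n m. A.pos (a x) = n \<and> B.pos (b x) = m \<and> m = n)"
    using Sig_conj[OF A Sig_conj[OF B Sig_pr_pred[OF pr_pred_eq[OF pr_fun_pfst[OF pr_fun_id]
      pr_fun_pfst[OF pr_fun_psnd[OF pr_fun_id]]]]]]
    unfolding numeral_3_eq_3 by (intro Sig_ex)
  moreover have "Sig 3 (\<lambda>x. \<exists>n m. A.pos (a x) = n \<and> B.pos (b x) = m \<and> m \<noteq> n)"
    using Sig_conj[OF A Sig_conj[OF B Sig_pr_pred[OF pr_pred_not[OF pr_pred_eq[OF pr_fun_pfst[OF pr_fun_id]
      pr_fun_pfst[OF pr_fun_psnd[OF pr_fun_id]]]]]]]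
    unfolding numeral_3_eq_3 by (intro Sig_ex)
  ultimately show ?thesis by (simp add: Del_def eq_commute del: Sig.simps)
qed

lemma Del_good_code:
  assumes "pr_fun {} z" "pr_fun {} s" "pr_fun {} a" "pr_fun {} b"
  shows "Del (\<lambda>x. good_code (z x) (s x) (a x) (b x))"
  unfolding good_code_def ok_def
  by (intro Del_conj Del_pos_eq Del_ball Del_iff A.Del_lab_less B.Del_lab_less assms
      assms[THEN pr_fun_comp] pr_fun_intros pr_fun_seqnth)

lemma Del_valid:
  assumes "pr_fun {} z" "pr_fun {} s"
  shows "Del (\<lambda>x. valid (z x) (s x))"
  unfolding valid_def Let_def
  by (intro Del_conj Del_disj Del_not Del_ball Del_good_code Del_pr_pred[OF pr_pred_eq] assms
      assms[THEN pr_fun_comp] pr_fun_intros pr_fun_seqnth)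

lemma Sig_forth: "Sig 3 (\<lambda>z. forth (pfst z) = psnd z)"
proof -
  have "Del (\<lambda>u. (\<forall>s<Suc (2 * pfst (psnd u)). valid (pfst u) s) \<and>
      psnd (seqnth (pfst u) (2 * pfst (psnd u))) = psnd (psnd u))"
    by (intro Del_conj Del_ball Del_valid Del_pr_pred[OF pr_pred_eq] pr_fun_intros pr_fun_seqnth)
  then show ?thesis
    unfolding forth_graph numeral_3_eq_3 Del_def by (intro Sig_ex) simp
qed

lemma delta_isomorphism:
  "\<exists>f. isomorphism A B f \<and> f \<in> delta_functions 3 \<and> inv f \<in> delta_functions 3"
proof -
  have "bij forth" using forth_isomorphism by (simp add: isomorphism_def)
  then have "inv forth a = b \<longleftrightarrow> forth b = a" for a b by (metis bij_inv_eq_iff)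
  \<comment> \<open>The inverse has the same graph with the arguments exchanged.\<close>
  moreover have "Sig 3 (\<lambda>z. forth (psnd z) = pfst z)"
    by (rule Sig_subst_cong[OF Sig_forth, of "\<lambda>z. pair (psnd z) (pfst z)"])
      ((intro pr_fun_intros)[1], simp)
  ultimately have "Sig 3 (\<lambda>z. inv forth (pfst z) = psnd z)" by (simp del: Sig.simps)
  then show ?thesis using Sig_forth Sig_graph_delta_functions forth_isomorphism by blast
qed

end

lemma punctual_iff: "punctual A \<longleftrightarrow> pr_pred {} (\<lambda>z. A (pfst z) (psnd z))"
proof
  assume "punctual A"
  then have "pr_fun2 {} (\<lambda>x y. of_bool (A x y))" by (simp add: punctual_def pr_fun2_def)
  then show "pr_pred {} (\<lambda>z. A (pfst z) (psnd z))"
    by (rule pr_fun_comp2[of "{}" "\<lambda>x y. of_bool (A x y)"]) (intro pr_fun_intros)+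
next
  assume A: "pr_pred {} (\<lambda>z. A (pfst z) (psnd z))"
  have "prim_rec_over {} 2 (\<lambda>xs. pair (xs ! 0) (xs ! 1))"
    by (intro prim_rec_over_comp2[OF pr_fun2_pair] prim_rec_over.proj) auto
  from prim_rec_over_comp1[OF A this] show "punctual A" by (simp add: punctual_def)
qed

lemma isomorphic_omega_eta_block_order:
  assumes "isomorphic A omega_eta"
  shows "\<exists>lab :: 'a \<Rightarrow> rat. block_order A lab"
  using assms block_order_isomorphism[OF _ block_order_omega_eta] unfolding isomorphic_def by blast

text \<open>The back-and-forth construction needs both orders on the naturals, so
  \<open>omega_eta\<close> is first transported along a bijection \<open>h\<close>.\<close>

lemma block_order_isomorphic_omega_eta:
  assumes "block_order (A :: nat \<Rightarrow> nat \<Rightarrow> bool) lab"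
  shows "isomorphic A omega_eta"
proof -
  have "infinite (UNIV :: (nat \<times> rat) set)" by (simp add: finite_prod infinite_UNIV_char_0)
  then obtain h :: "nat \<Rightarrow> nat \<times> rat" where h: "bij h"
    using bij_betw_from_nat_into[of "UNIV :: (nat \<times> rat) set"] by auto
  let ?B = "\<lambda>x y. omega_eta (h x) (h y)"
  have iso: "isomorphism ?B omega_eta h" using h by (simp add: isomorphism_def)
  interpret two_block_orders A ?B lab "snd \<circ> h"
    using assms block_order_isomorphism[OF iso block_order_omega_eta]
    by (simp add: two_block_orders_def)
  show ?thesis
    using isomorphism_comp[OF forth_isomorphism iso] by (auto simp: isomorphic_def)
qed

lemma delta_isomorphism_omega_eta:
  assumes "punctual A" "isomorphic A omega_eta" "punctual B" "isomorphic B omega_eta"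
  shows "\<exists>f. isomorphism A B f \<and> f \<in> delta_functions 3 \<and> inv f \<in> delta_functions 3"
proof -
  obtain la :: "nat \<Rightarrow> rat" where "block_order A la"
    using isomorphic_omega_eta_block_order assms(2) by blast
  moreover obtain lb :: "nat \<Rightarrow> rat" where "block_order B lb"
    using isomorphic_omega_eta_block_order assms(4) by blast
  ultimately interpret two_pr_block_orders A B la lb
    using assms(1,3)
    by (simp add: two_pr_block_orders_def pr_block_order_def pr_block_order_axioms_def punctual_iff)
  show ?thesis by (rule delta_isomorphism)
qed


section \<open>A punctual presentation with computable blocks\<close>

lemma nonneg_rat_fraction:
  assumes "(q :: rat) \<ge> 0"
  obtains m n where "n > 0" "q = of_nat m / of_nat n"
proof -
  obtain a b where ab: "quotient_of q = (a, b)" by fastforce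
  have "b > 0" using quotient_of_denom_pos[OF ab] .
  moreover have "q = of_int a / of_int b" using quotient_of_div[OF ab] .
  moreover from this \<open>b > 0\<close> assms have "a \<ge> 0" by (simp add: zero_le_divide_iff)
  ultimately show thesis using that[of "nat b" "nat a"] by simp
qed

text \<open>Fractions are not reduced, so every positive rational has infinitely many codes. These
  codes form its block in \<open>std\<close>.\<close>

definition pos_rat :: "nat \<Rightarrow> rat"
  where "pos_rat z = of_nat (Suc (pfst z)) / of_nat (Suc (psnd z))"

definition nonneg_rat :: "nat \<Rightarrow> rat"
  where "nonneg_rat z = of_nat (pfst z) / of_nat (Suc (psnd z))"

text \<open>Expanding a fraction with denominator \<open>n\<close> by \<open>Suc k\<close> gives the
  denominator \<open>Suc k * n\<close>, which is stored as its predecessor. It determines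
  \<open>k\<close>, so the codes are distinct.\<close>

lemma infinite_fraction:
  assumes "n > 0" and f: "\<And>k. psnd (f k) = Suc k * n - 1" and P: "\<And>k. P (f k)"
  shows "infinite {z :: nat. P z}"
proof -
  have "inj f"
  proof (rule injI)
    fix k l assume "f k = f l"
    then have "Suc k * n - 1 = Suc l * n - 1" using f by metis
    moreover have "Suc k * n \<ge> 1" "Suc l * n \<ge> 1" using assms(1) by simp_all
    ultimately have "Suc k * n = Suc l * n" by linarith
    with assms(1) show "k = l" by simp
  qed
  then have "infinite (range f)" by (rule range_inj_infinite)
  moreover have "range f \<subseteq> {z. P z}" using P by auto
  ultimately show ?thesis using infinite_super by blast
qed

lemma infinite_nonneg_rat:
  assumes "q \<ge> 0"
  shows "infinite {z. nonneg_rat z = q}"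
proof -
  obtain m n where n: "n > 0" and q: "q = of_nat m / of_nat n"
    using assms by (rule nonneg_rat_fraction)
  show ?thesis
  proof (rule infinite_fraction[OF n, of "\<lambda>k. pair (Suc k * m) (Suc k * n - 1)"])
    fix k
    have "Suc (Suc k * n - 1) = Suc k * n" using n by simp
    then have "nonneg_rat (pair (Suc k * m) (Suc k * n - 1)) = of_nat (Suc k * m) / of_nat (Suc k * n)"
      unfolding nonneg_rat_def by (simp only: pfst_pair psnd_pair)
    also have "\<dots> = q" unfolding q of_nat_mult
      by (rule mult_divide_mult_cancel_left) (simp del: of_nat_Suc)
    finally show "nonneg_rat (pair (Suc k * m) (Suc k * n - 1)) = q" .
  qed simp
qed

lemma infinite_pos_rat:
  assumes "q > 0"
  shows "infinite {z. pos_rat z = q}"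
proof -
  obtain m n where n: "n > 0" and q: "q = of_nat m / of_nat n"
    using order.strict_implies_order[OF assms] by (rule nonneg_rat_fraction)
  with assms have m: "m > 0" by (cases m) auto
  show ?thesis
  proof (rule infinite_fraction[OF n, of "\<lambda>k. pair (Suc k * m - 1) (Suc k * n - 1)"])
    fix k
    have "Suc (Suc k * n - 1) = Suc k * n" "Suc (Suc k * m - 1) = Suc k * m" using n m by simp_all
    then have "pos_rat (pair (Suc k * m - 1) (Suc k * n - 1)) = of_nat (Suc k * m) / of_nat (Suc k * n)"
      unfolding pos_rat_def by (simp only: pfst_pair psnd_pair)
    also have "\<dots> = q" unfolding q of_nat_mult
      by (rule mult_divide_mult_cancel_left) (simp del: of_nat_Suc)
    finally show "pos_rat (pair (Suc k * m - 1) (Suc k * n - 1)) = q" .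
  qed simp
qed

lemma pos_rat_pos: "pos_rat z > 0"
  by (simp add: pos_rat_def del: of_nat_Suc)

lemma nonneg_rat_nonneg: "nonneg_rat z \<ge> 0"
  by (simp add: nonneg_rat_def del: of_nat_Suc)

lemma pos_rat_surj: "q > 0 \<Longrightarrow> \<exists>z. pos_rat z = q"
  using infinite_pos_rat not_finite_existsD by blast

lemma frac_less_iff:
  "(of_nat a / of_nat (Suc b) :: rat) < of_nat c / of_nat (Suc d) \<longleftrightarrow> a * Suc d < c * Suc b"
  by (simp only: pos_divide_less_eq times_divide_eq_left pos_less_divide_eq of_nat_0_less_iff zero_less_Suc
      of_nat_less_iff flip: of_nat_mult)

lemma frac_eq_iff:
  "(of_nat a / of_nat (Suc b) :: rat) = of_nat c / of_nat (Suc d) \<longleftrightarrow> a * Suc d = c * Suc b"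
  by (simp only: frac_eq_eq of_nat_eq_0_iff nat.distinct simp_thms of_nat_eq_iff flip: of_nat_mult)

text \<open>Sharing a block is decided by cross multiplication. Inside a block the points are
  ordered by their codes, so the code of a point bounds the number of its predecessors
  there.\<close>

definition std :: "nat \<Rightarrow> nat \<Rightarrow> bool"
  where "std x y \<longleftrightarrow> pos_rat x < pos_rat y \<or> pos_rat x = pos_rat y \<and> x \<le> y"

lemma block_order_std: "block_order std pos_rat"
proof
  show "finite {y. pos_rat y = pos_rat x \<and> std y x}" for x
    by (rule finite_subset[of _ "{..x}"]) (auto simp: std_def)
  show "infinite {y. pos_rat y = pos_rat x}" for x
    by (rule infinite_pos_rat[OF pos_rat_pos])
  show "\<exists>z. pos_rat x < pos_rat z \<and> pos_rat z < pos_rat y" if "pos_rat x < pos_rat y" for x y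
    using Orderings.dense[OF that] pos_rat_surj pos_rat_pos[of x] by (metis less_trans)
  show "\<exists>y. pos_rat x < pos_rat y" for x
    using pos_rat_surj[of "pos_rat x + 1"] pos_rat_pos[of x]
    by (metis add_pos_pos less_add_one zero_less_one)
  show "\<exists>y. pos_rat y < pos_rat x" for x
    using pos_rat_surj pos_rat_pos[of x] Orderings.dense by metis
qed (auto simp: std_def)

lemma pr_pos_rat_eq:
  "pr_fun X a \<Longrightarrow> pr_fun X b \<Longrightarrow> pr_pred X (\<lambda>x. pos_rat (a x) = pos_rat (b x))"
  unfolding pos_rat_def frac_eq_iff by (intro pr_fun_intros)

lemma punctual_std: "punctual std"
  unfolding punctual_iff std_def pos_rat_def frac_eq_iff frac_less_iff by (intro pr_fun_intros)


section \<open>Coding infinite sets into blocks\<close>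

lemma pair_le_iff: "pair n u \<le> pair n v \<longleftrightarrow> u \<le> v"
proof -
  have mono: "pair n u \<le> pair n v" if "u \<le> v" for u v
    using that by (induction rule: dec_induct) (auto simp: pair_def prod_encode_def)
  show ?thesis using mono[of u v] mono[of v u] by (cases "u = v") force+
qed

lemma pair_0 [simp]: "pair 0 0 = 0"
  by (simp add: pair_def prod_encode_def)

lemma card_less_enumerate:
  fixes S :: "nat set"
  assumes "infinite S"
  shows "card {y \<in> S. y < enumerate S c} = c"
proof -
  have "{y \<in> S. y < enumerate S c} = enumerate S ` {..<c}"
  proof (intro equalityI subsetI)
    fix y assume *: "y \<in> {y \<in> S. y < enumerate S c}"
    then obtain i where "y = enumerate S i" using range_enumerate[OF assms] by blast
    with * show "y \<in> enumerate S ` {..<c}"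
      using strict_mono_enumerate[OF assms] by (auto simp: strict_mono_less)
  qed (use strict_mono_enumerate[OF assms] enumerate_in_set[OF assms] in \<open>auto simp: strict_mono_less\<close>)
  then show ?thesis
    using strict_mono_enumerate[OF assms] by (simp add: card_image strict_mono_imp_inj_on inj_on_subset)
qed

text \<open>
  The points with first component \<open>n\<close> and \<open>dk\<close>-value \<open>k\<close> form the \<open>n, k\<close>-segment. The segments
  are ordered by \<open>n\<close>, and for the same \<open>n\<close> downwards by \<open>k\<close>. A segment is filled with an initial
  part of a list of the points of \<open>\<omega> + \<omega> * \<eta>\<close>. An infinite segment starts a new
  block, but a finite one belongs to the first block of the next infinite segment.
\<close>

locale coding =
  fixes dk :: "nat \<Rightarrow> nat"
  assumes pr_dk: "pr_fun {} dk"
    and dk_start: "dk (pair n (pair k 0)) = k"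
    and dk_cases: "dk (pair n (pair k s)) = k \<or> dk (pair n (pair k s)) = 0"
    and full_unbounded: "\<exists>k\<ge>m. infinite {x. pfst x = n \<and> dk x = k}"
begin

definition segment :: "nat \<Rightarrow> nat \<Rightarrow> nat set"
  where "segment n k = {x. pfst x = n \<and> dk x = k}"

definition full :: "nat \<Rightarrow> nat \<Rightarrow> bool"
  where "full n k \<longleftrightarrow> infinite (segment n k)"

definition rank :: "nat \<Rightarrow> nat"
  where "rank x = (\<Sum>y<x. of_bool (pfst y = pfst x \<and> dk y = dk x))"

text \<open>The sign makes segments with the same first component descend. The rank of a point in
  its segment is read as a fraction, so an infinite segment realizes every nonnegative rational
  infinitely often and has a first block, that of \<open>0\<close>.\<close>

definition place :: "nat \<Rightarrow> nat \<times> int \<times> rat"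
  where "place x = (pfst x, - int (dk x), nonneg_rat (rank x))"

definition coded :: "nat \<Rightarrow> nat \<Rightarrow> bool"
  where "coded x y \<longleftrightarrow> place x < place y \<or> place x = place y \<and> x \<le> y"

text \<open>A smaller index lies further to the right, so the next infinite segment has the greatest
  index up to \<open>k\<close> among the infinite ones.\<close>

definition next_full :: "nat \<Rightarrow> nat \<Rightarrow> nat"
  where "next_full n k = (GREATEST j. j \<le> k \<and> full n j)"

definition block :: "nat \<Rightarrow> nat \<times> int \<times> rat"
  where "block x = (pfst x, - int (next_full (pfst x) (dk x)),
    if full (pfst x) (dk x) then nonneg_rat (rank x) else 0)"

lemma dk_0: "dk (pair n (pair 0 s)) = 0"
  using dk_cases[of n 0 s] by blast

text \<open>Segment \<open>0\<close> gets every point offered to it. Hence the maximum in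
  \<open>next_full\<close> is always taken over a nonempty set.\<close>

lemma full_0: "full n 0"
proof -
  have "inj (\<lambda>s. pair n (pair 0 s))" by (rule injI) simp
  then have "infinite (range (\<lambda>s. pair n (pair 0 s)))" by (rule range_inj_infinite)
  moreover have "range (\<lambda>s. pair n (pair 0 s)) \<subseteq> segment n 0" by (auto simp: segment_def dk_0)
  ultimately show ?thesis unfolding full_def using infinite_super by blast
qed

lemma full_next_full: "full n (next_full n k)"
  and next_full_le: "next_full n k \<le> k"
proof -
  have "next_full n k \<le> k \<and> full n (next_full n k)"
    unfolding next_full_def
    by (rule GreatestI_nat[of "\<lambda>j. j \<le> k \<and> full n j" 0 k]) (auto simp: full_0)
  then show "full n (next_full n k)" "next_full n k \<le> k" by auto
qed

lemma le_next_full: "j \<le> k \<Longrightarrow> full n j \<Longrightarrow> j \<le> next_full n k"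
  unfolding next_full_def by (rule Greatest_le_nat[of _ _ k]) auto

lemma next_full_mono: "j \<le> k \<Longrightarrow> next_full n j \<le> next_full n k"
  using le_next_full next_full_le full_next_full by (meson order.trans)

lemma next_full_eq: "full n k \<Longrightarrow> next_full n k = k"
  using le_next_full[of k k n] next_full_le[of n k] by simp

lemma next_full_Suc: "next_full n (Suc k) = (if full n (Suc k) then Suc k else next_full n k)"
proof (cases "full n (Suc k)")
  case False
  then have "next_full n (Suc k) \<noteq> Suc k" using full_next_full[of n "Suc k"] by metis
  then have "next_full n (Suc k) \<le> k" using next_full_le[of n "Suc k"] by simp
  then show ?thesis
    using False le_next_full[OF _ full_next_full, of n "Suc k" k] next_full_mono[of k "Suc k" n] by simp
qed (simp add: next_full_eq)

lemma rank_eq_card: "rank x = card {y \<in> segment (pfst x) (dk x). y < x}"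
proof -
  have "{..<x} \<inter> {y. pfst y = pfst x \<and> dk y = dk x} = {y \<in> segment (pfst x) (dk x). y < x}"
    by (auto simp: segment_def)
  then show ?thesis by (simp add: rank_def sum_of_bool_eq)
qed

text \<open>The member number \<open>c\<close> of an infinite segment has rank \<open>c\<close>, and
  infinitely many \<open>c\<close> code the fraction \<open>q\<close>.\<close>

lemma infinite_block:
  assumes "full n k" "q \<ge> 0"
  shows "infinite {x. block x = (n, - int k, q)}"
proof -
  let ?e = "enumerate (segment n k)"
  have S: "infinite (segment n k)" using assms(1) by (simp add: full_def)
  have "block (?e c) = (n, - int k, nonneg_rat c)" for c
  proof -
    have "?e c \<in> segment n k" by (rule enumerate_in_set[OF S])
    then have *: "pfst (?e c) = n" "dk (?e c) = k" by (auto simp: segment_def)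
    then have "rank (?e c) = c" by (simp add: rank_eq_card card_less_enumerate[OF S])
    with * assms(1) show ?thesis by (simp add: block_def next_full_eq)
  qed
  then have "?e ` {c. nonneg_rat c = q} \<subseteq> {x. block x = (n, - int k, q)}" by auto
  moreover have "infinite (?e ` {c. nonneg_rat c = q})"
    using infinite_nonneg_rat[OF assms(2)] strict_mono_enumerate[OF S]
    by (simp add: finite_image_iff strict_mono_imp_inj_on inj_on_subset)
  ultimately show ?thesis using infinite_super by blast
qed

lemma block_exists: "full n k \<Longrightarrow> q \<ge> 0 \<Longrightarrow> \<exists>x. block x = (n, - int k, q)"
  using infinite_block not_finite_existsD by blast

lemma block_cases:
  obtains n k q where "block x = (n, - int k, q)" "full n k" "q \<ge> 0"
proof
  show "block x = (pfst x, - int (next_full (pfst x) (dk x)),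
    if full (pfst x) (dk x) then nonneg_rat (rank x) else 0)" by (rule block_def)
qed (simp_all add: full_next_full nonneg_rat_nonneg)

lemma block_mono:
  assumes "place x \<le> place y"
  shows "block x \<le> block y"
proof -
  consider "pfst x < pfst y" | "pfst x = pfst y" "dk y < dk x"
    | "pfst x = pfst y" "dk x = dk y" "nonneg_rat (rank x) \<le> nonneg_rat (rank y)"
    using assms by (fastforce simp: place_def)
  then show ?thesis
  proof cases
    \<comment> \<open>Here \<open>x\<close> lies in an earlier segment. If that segment is infinite,
      the second component of the label increases strictly; otherwise \<open>x\<close> carries the
      least fraction, \<open>0\<close>.\<close>
    case 2
    show ?thesis
    proof (cases "full (pfst x) (dk x)")
      case True
      then show ?thesis using 2 next_full_le[of "pfst x" "dk y"] by (auto simp: block_def next_full_eq)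
    next
      case False
      then show ?thesis using 2 next_full_mono[of "dk y" "dk x" "pfst x"] nonneg_rat_nonneg
        by (auto simp: block_def)
    qed
  qed (auto simp: block_def)
qed

lemma block_order_coded: "block_order coded block"
proof
  show "coded x y \<Longrightarrow> block x \<le> block y" for x y
    using block_mono[of x y] by (auto simp: coded_def)
  show "finite {y. block y = block x \<and> coded y x}" for x
  proof -
    let ?n = "pfst x" and ?K = "next_full (pfst x) (dk x)"
    \<comment> \<open>The points of the block outside its infinite segment come from finite segments
      with index below \<open>K'\<close>, so they are finitely many. Those below \<open>x\<close>
      inside the infinite segment have the same place as \<open>x\<close> and hence codes up to
      \<open>x\<close>.\<close>
    obtain K' where K': "K' > ?K" "full ?n K'"
      using full_unbounded[of "Suc ?K" ?n] by (auto simp: full_def segment_def Suc_le_eq)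
    have "y \<le> x \<or> (\<exists>j<K'. \<not> full ?n j \<and> y \<in> segment ?n j)" if y: "block y = block x" "coded y x" for y
    proof (cases "full ?n (dk y)")
      case True
      then have dk: "pfst y = ?n" "dk y = ?K" using y(1) by (auto simp: block_def next_full_eq)
      have "\<not> dk y < dk x" using y(2) dk(1) by (auto simp: coded_def place_def)
      then have "dk x = dk y" using dk(2) next_full_le[of ?n "dk x"] by simp
      then have "place y = place x" using True y(1) dk(1) by (simp add: block_def place_def)
      then show ?thesis using y(2) by (simp add: coded_def)
    next
      case False
      have n: "pfst y = ?n" "next_full ?n (dk y) = ?K" using y(1) by (auto simp: block_def)
      then have "\<not> K' \<le> dk y" using le_next_full[OF _ K'(2), of "dk y"] K'(1) by auto
      then show ?thesis using False n(1) by (auto simp: segment_def)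
    qed
    then have "{y. block y = block x \<and> coded y x} \<subseteq> {..x} \<union> (\<Union>j\<in>{j. j < K' \<and> \<not> full ?n j}. segment ?n j)"
      by auto
    moreover have "finite ({..x} \<union> (\<Union>j\<in>{j. j < K' \<and> \<not> full ?n j}. segment ?n j))"
      by (auto simp: full_def)
    ultimately show ?thesis by (rule finite_subset)
  qed
  show "infinite {y. block y = block x}" for x
    using infinite_block by (metis block_cases)
  show "\<exists>z. block x < block z \<and> block z < block y" if less: "block x < block y" for x y
  proof -
    obtain n k q where x: "block x = (n, - int k, q)" "full n k" "q \<ge> 0" by (rule block_cases)
    obtain n' k' q' where y: "block y = (n', - int k', q')" by (metis block_cases)
    \<comment> \<open>Within one infinite segment the midpoint is taken; otherwise a later block in
      the segment of the block of \<open>x\<close> will do.\<close>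
    define p where "p = (if n = n' \<and> k = k' then (q + q') / 2 else q + 1)"
    have "q < p" using less by (auto simp: p_def x(1) y split: if_splits)
    then obtain z where "block z = (n, - int k, p)" using block_exists[OF x(2), of p] x(3) by fastforce
    moreover have "(n, - int k, p) < (n', - int k', q')"
      using less unfolding x(1) y by (auto simp: p_def)
    ultimately show ?thesis using \<open>q < p\<close> x(1) y by (intro exI[of _ z]) simp
  qed
  show "\<exists>y. block x < block y" for x
  proof -
    obtain n k q where x: "block x = (n, - int k, q)" "full n k" "q \<ge> 0" by (rule block_cases)
    then obtain y where "block y = (n, - int k, q + 1)" using block_exists[of n k "q + 1"] by auto
    with x show ?thesis by (intro exI[of _ y]) simp
  qed
  show "\<exists>y. block y < block x" for x
  proof -
    obtain n k q where x: "block x = (n, - int k, q)" "full n k" "q \<ge> 0" by (rule block_cases)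
    \<comment> \<open>A larger index lies further to the left.\<close>
    obtain k' where "k' > k" "full n k'"
      using full_unbounded[of "Suc k" n] by (auto simp: full_def segment_def Suc_le_eq)
    moreover from this obtain y where "block y = (n, - int k', 0)" using block_exists[of n k' 0] by auto
    ultimately show ?thesis using x by (intro exI[of _ y]) simp
  qed
qed (auto simp: coded_def)

section \<open>Punctuality of the coded order and recovery of the events\<close>

lemma punctual_coded: "punctual coded"
proof -
  have rank: "pr_fun {} (\<lambda>x. rank (a x))" if "pr_fun {} a" for a
    unfolding rank_def by (intro pr_fun_intros pr_fun_comp[OF pr_dk] pr_fun_comp[OF that] that)
  have "coded x y \<longleftrightarrow> (pfst x < pfst y \<or> pfst x = pfst y \<and> (dk y < dk x \<or> dk x = dk y \<and>
      (nonneg_rat (rank x) < nonneg_rat (rank y) \<or> nonneg_rat (rank x) = nonneg_rat (rank y) \<and> x \<le> y)))"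
    for x y by (auto simp: coded_def place_def)
  then show ?thesis
    unfolding punctual_iff nonneg_rat_def frac_eq_iff frac_less_iff
    by (simp only:) (intro pr_fun_intros rank pr_fun_comp[OF pr_dk])
qed

text \<open>These are the points \<open>b (n, k)\<close> of the introductory text.\<close>

definition start :: "nat \<Rightarrow> nat \<Rightarrow> nat"
  where "start n k = pair n (pair k 0)"

lemma pfst_start: "pfst (start n k) = n"
  and dk_start': "dk (start n k) = k"
  unfolding start_def by (rule pfst_pair, rule dk_start)

lemma rank_start: "rank (start n k) = 0"
proof -
  have "start n k \<le> y" if y_seg: "pfst y = n" "dk y = k" for y
  proof -
    obtain j s where y: "y = pair n (pair j s)" using y_seg(1) by (metis pair_pfst_psnd)
    \<comment> \<open>Segment \<open>0\<close> also collects the points rejected by other segments;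
      its start is still least because \<open>pair 0 0 = 0\<close>.\<close>
    then have "j = k \<or> k = 0" using y_seg(2) dk_cases[of n j s] by auto
    then show ?thesis unfolding y start_def pair_le_iff using pair_le_iff[of k 0 s] by auto
  qed
  then show ?thesis by (fastforce simp: rank_def pfst_start dk_start')
qed

lemma block_start: "block (start n k) = (n, - int (next_full n k), 0)"
proof -
  have "pfst 0 = 0" using pfst_pair[of 0 0] by simp
  then have "nonneg_rat (rank (start n k)) = 0" unfolding rank_start by (simp add: nonneg_rat_def)
  then show ?thesis by (simp add: block_def pfst_start dk_start')
qed

text \<open>Neighbouring starts lie in different blocks iff segment \<open>Suc j\<close> is
  infinite. Up to the least such \<open>j\<close> the starts share the block of
  \<open>start n 0\<close> and lie at or below it. Their images in \<open>std\<close> are then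
  distinct numbers up to \<open>h (start n 0)\<close>, which bounds \<open>j\<close>.\<close>

lemma least_full:
  assumes iso: "isomorphism coded std h"
  defines "Q \<equiv> \<lambda>j n. pos_rat (h (start n (Suc j))) \<noteq> pos_rat (h (start n j))"
  shows "full n (Suc (LEAST j. Q j n))" and "\<exists>j\<le>h (start n 0). Q j n"
proof -
  interpret C: block_order coded block by (rule block_order_coded)
  interpret S: block_order coded "pos_rat \<circ> h"
    by (rule block_order_isomorphism[OF iso block_order_std])
  \<comment> \<open>Both labellings belong to the same order, which determines the blocks.\<close>
  have less: "pos_rat (h x) < pos_rat (h y) \<longleftrightarrow> block x < block y" for x y
    using C.lab_less_iff_infinite S.lab_less_iff_infinite by simp
  have eq: "pos_rat (h x) = pos_rat (h y) \<longleftrightarrow> block x = block y" for x y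
    using less[of x y] less[of y x] by (metis less_irrefl linorder_neqE)
  have Q: "Q j n \<longleftrightarrow> full n (Suc j)" for j
    unfolding Q_def eq block_start next_full_Suc using next_full_le[of n j] by auto
  obtain k where k: "k \<ge> 1" "full n k"
    using full_unbounded[of 1 n] by (auto simp: full_def segment_def)
  then have ex: "Q (k - 1) n" by (simp add: Q)
  then show "full n (Suc (LEAST j. Q j n))" using LeastI[of "\<lambda>j. Q j n"] Q by blast
  define m where "m = (LEAST j. Q j n)"
  have m: "Q m n" unfolding m_def by (rule LeastI[of "\<lambda>j. Q j n", OF ex])
  have "h (start n i) \<le> h (start n 0)" if "i \<le> m" for i
  proof -
    have "block (start n i) = block (start n 0)" using that
    proof (induction i)
      case (Suc i)
      then have "\<not> Q i n" using not_less_Least[of i "\<lambda>j. Q j n"] by (simp add: m_def)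
      with Suc show ?case by (simp add: Q_def eq)
    qed simp
    then have "pos_rat (h (start n i)) = pos_rat (h (start n 0))" by (simp add: eq)
    moreover have "coded (start n i) (start n 0)"
      by (cases i) (auto simp: coded_def place_def pfst_start dk_start')
    then have "std (h (start n i)) (h (start n 0))" using iso by (simp add: isomorphism_def)
    ultimately show ?thesis by (simp add: std_def)
  qed
  then have "(\<lambda>i. h (start n i)) ` {..m} \<subseteq> {..h (start n 0)}" by auto
  moreover have "inj_on (\<lambda>i. h (start n i)) {..m}"
    using iso dk_start' by (intro inj_onI) (metis isomorphism_def bij_is_inj injD)
  ultimately have "card {..m} \<le> card {..h (start n 0)}"
    by (intro card_inj_on_le) auto
  then have "m \<le> h (start n 0)" by simp
  with m show "\<exists>j\<le>h (start n 0). Q j n" by blast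
qed

end


text \<open>An element \<open>pair v w\<close> consists of \<open>v\<close> and the least
  \<open>w\<close> that bounds witnesses for all \<open>v' \<le> v\<close>. For each
  \<open>v\<close> there is at most one such \<open>w\<close>, and there is one iff all
  \<open>v' \<le> v\<close> have witnesses.\<close>

lemma infinite_witness_iff:
  fixes M :: "nat \<Rightarrow> nat \<Rightarrow> bool"
  defines "C \<equiv> \<lambda>w v. \<forall>v'<Suc v. \<exists>w'<Suc w. M w' v'"
  shows "infinite {s. C (psnd s) (pfst s) \<and> (\<forall>w<psnd s. \<not> C w (pfst s))} \<longleftrightarrow> (\<forall>v. \<exists>w. M w v)"
    (is "infinite ?F \<longleftrightarrow> _")
proof
  assume inf: "infinite ?F"
  have "inj_on pfst ?F"
  proof (rule inj_onI)
    fix s t assume *: "s \<in> ?F" "t \<in> ?F" "pfst s = pfst t"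
    then have "psnd s = psnd t" by (metis (mono_tags, lifting) linorder_neqE_nat mem_Collect_eq)
    with *(3) show "s = t" by (metis pair_pfst_psnd)
  qed
  with inf have "infinite (pfst ` ?F)" using finite_imageD by blast
  then have "\<exists>s\<in>?F. v \<le> pfst s" for v
    unfolding finite_nat_set_iff_bounded by (auto simp: not_less)
  then have *: "\<exists>s. C (psnd s) (pfst s) \<and> v \<le> pfst s" for v by blast
  show "\<forall>v. \<exists>w. M w v"
  proof
    fix v
    obtain s where "C (psnd s) (pfst s)" "v < Suc (pfst s)" using * less_Suc_eq_le by blast
    then show "\<exists>w. M w v" unfolding C_def by blast
  qed
next
  assume M: "\<forall>v. \<exists>w. M w v"
  have "v \<in> pfst ` ?F" for v
  proof -
    obtain f where f: "M (f v) v" for v using M by metis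
    have "C (Max (f ` {..v})) v"
      unfolding C_def
    proof (intro allI impI)
      fix u assume "u < Suc v"
      then have "f u < Suc (Max (f ` {..v}))" by (simp add: less_Suc_eq_le)
      with f show "\<exists>w<Suc (Max (f ` {..v})). M w u" by blast
    qed
    then obtain m where "C m v" "\<forall>w<m. \<not> C w v"
      using exists_least_iff[of "\<lambda>w. C w v"] by blast
    then have "pair v m \<in> ?F" by simp
    from imageI[OF this, of pfst] show ?thesis by (simp only: pfst_pair)
  qed
  then have "pfst ` ?F = UNIV" by blast
  then show "infinite ?F" using finite_imageI[of ?F pfst] infinite_UNIV_nat by auto
qed

lemma delta_functions_Sig:
  assumes "g \<in> delta_functions 3"
  shows "Sig 3 (\<lambda>z. g (pfst z) = psnd z)"
proof -
  have "arith_sigma (Suc 2) 2 (\<lambda>xs. g (xs ! 0) = xs ! 1)"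
    using assms by (simp add: delta_functions_def arith_delta_def numeral_3_eq_3 del: arith_sigma.simps)
  from Sig_arith_sigma[OF this]
  have "Sig 3 (\<lambda>z. g (pfst z) = pfst (psnd z))"
    by (simp add: numeral_2_eq_2 numeral_3_eq_3 del: Sig.simps)
  then show ?thesis
    by (rule Sig_subst_cong[of _ _ "\<lambda>z. pair (pfst z) (pair (psnd z) 0)"])
      ((intro pr_fun_intros)[1], simp)
qed

text \<open>
  An event \<open>j\<close> codes \<open>((u, y), m)\<close>, where \<open>u\<close> is the outermost witness of \<open>g n = y\<close>. The padding \<open>m\<close>
  makes infinitely many segments infinite for each \<open>n\<close>.
\<close>

lemma delta_function_coding:
  assumes "g \<in> delta_functions 3"
  shows "\<exists>dk. coding dk \<and> (\<forall>n j. infinite {x. pfst x = n \<and> dk x = Suc j} \<longrightarrow> g n = psnd (pfst j))"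
proof -
  have "Sig (Suc (Suc (Suc 0))) (\<lambda>z. g (pfst z) = psnd z)"
    using delta_functions_Sig[OF assms] by (simp only: numeral_3_eq_3)
  then obtain Q1 where Q1: "Sig (Suc (Suc 0)) (\<lambda>z. \<not> Q1 z)"
    "\<And>x. g (pfst x) = psnd x \<longleftrightarrow> (\<exists>y. Q1 (pair y x))" unfolding Sig.simps(2)[of "Suc (Suc 0)"] by blast
  then obtain Q2 where Q2: "Sig (Suc 0) (\<lambda>z. \<not> Q2 z)" "\<And>x. \<not> Q1 x \<longleftrightarrow> (\<exists>y. Q2 (pair y x))"
    unfolding Sig.simps(2)[of "Suc 0"] by blast
  then obtain Q3 where Q3: "pr_pred {} (\<lambda>z. \<not> Q3 z)" "\<And>x. \<not> Q2 x \<longleftrightarrow> (\<exists>y. Q3 (pair y x))"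
    by auto
  \<comment> \<open>For fixed \<open>n\<close> and \<open>j\<close> the \<Pi>_2 condition given by
    \<open>Q1\<close> takes the form: for all \<open>v\<close> some \<open>w\<close> satisfies
    \<open>M\<close>.\<close>
  define M where "M n j w v \<longleftrightarrow> Q3 (pair w (pair v (pair (pfst (pfst j)) (pair n (psnd (pfst j))))))"
    for n j w v
  have M: "(\<forall>v. \<exists>w. M n j w v) \<longleftrightarrow> Q1 (pair (pfst (pfst j)) (pair n (psnd (pfst j))))" for n j
    using Q2(2) Q3(2) unfolding M_def by blast
  have prM: "pr_pred {} (\<lambda>x. M (a x) (b x) (c x) (d x))"
    if "pr_fun {} a" "pr_fun {} b" "pr_fun {} c" "pr_fun {} d" for a b c d
  proof -
    have "pr_pred {} Q3" using pr_pred_not[OF Q3(1)] by simp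
    then show ?thesis
      unfolding M_def by (rule pr_fun_comp[of _ "\<lambda>x. of_bool (Q3 x)"]) (intro pr_fun_intros that)
  qed
  define C where "C n j w v \<longleftrightarrow> (\<forall>v'<Suc v. \<exists>w'<Suc w. M n j w' v')" for n j w v
  define fires where "fires n j s \<longleftrightarrow> C n j (psnd s) (pfst s) \<and> (\<forall>w<psnd s. \<not> C n j w (pfst s))" for n j s
  \<comment> \<open>The point \<open>pair n (pair k s)\<close> enters segment \<open>k\<close> if
    \<open>s = 0\<close> or \<open>s\<close> fires for the event \<open>k - 1\<close>, and segment
    \<open>0\<close> otherwise. The shift by one leaves segment \<open>0\<close>, which is always
    infinite, without an event.\<close>
  define dk where "dk x = (if psnd (psnd x) = 0 \<or> fires (pfst x) (pfst (psnd x) - 1) (psnd (psnd x))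
    then pfst (psnd x) else 0)" for x
  have full: "infinite {x. pfst x = n \<and> dk x = Suc j} \<longleftrightarrow> Q1 (pair (pfst (pfst j)) (pair n (psnd (pfst j))))"
    for n j
  proof -
    have "{x. pfst x = n \<and> dk x = Suc j} = (\<lambda>s. pair n (pair (Suc j) s)) ` insert 0 {s. fires n j s}"
      (is "?L = ?f ` _")
    proof (intro equalityI subsetI)
      fix x assume x: "x \<in> ?L"
      then have "x = ?f (psnd (psnd x))"
        by (auto simp: dk_def split: if_splits) (metis pair_pfst_psnd)+
      then show "x \<in> ?f ` insert 0 {s. fires n j s}"
        using x by (auto simp: dk_def split: if_splits)
    qed (auto simp: dk_def)
    moreover have "inj ?f" by (rule injI) simp
    ultimately have "infinite {x. pfst x = n \<and> dk x = Suc j} \<longleftrightarrow> infinite {s. fires n j s}"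
      by (simp add: finite_image_iff inj_on_subset)
    also have "\<dots> \<longleftrightarrow> (\<forall>v. \<exists>w. M n j w v)"
      using infinite_witness_iff[of "M n j"] by (simp add: fires_def C_def)
    finally show ?thesis unfolding M .
  qed
  have "coding dk"
  proof
    show "pr_fun {} dk"
      unfolding dk_def fires_def C_def
      by (intro pr_fun_intros prM)
    show "\<exists>k\<ge>m. infinite {x. pfst x = n \<and> dk x = k}" for m n
    proof -
      obtain u where "Q1 (pair u (pair n (g n)))" using Q1(2)[of "pair n (g n)"] by auto
      then have "infinite {x. pfst x = n \<and> dk x = Suc (pair (pair u (g n)) m)}" by (simp add: full)
      moreover have "m \<le> Suc (pair (pair u (g n)) m)"
        unfolding pair_def using le_prod_encode_2[of m "prod_encode (u, g n)"] by linarith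
      ultimately show ?thesis by blast
    qed
  qed (auto simp: dk_def)
  moreover have "g n = psnd (pfst j)" if "infinite {x. pfst x = n \<and> dk x = Suc j}" for n j
    using that Q1(2)[of "pair n (psnd (pfst j))"] by (auto simp: full)
  ultimately show ?thesis by blast
qed

text \<open>With \<open>h\<close> available, comparing blocks in \<open>std\<close> and searching up
  to \<open>h (start n 0)\<close> finds the least event that happens. The value \<open>g n\<close>
  is then decoded from that event.\<close>

lemma delta_function_from_isomorphism:
  assumes "g \<in> delta_functions 3"
  shows "\<exists>B. punctual B \<and> isomorphic B omega_eta \<and>
    (\<forall>X h. isomorphism B std h \<longrightarrow> pr_fun X h \<longrightarrow> pr_fun X g)"
proof -
  obtain dk where "coding dk"
    and dk: "\<And>n j. infinite {x. pfst x = n \<and> dk x = Suc j} \<Longrightarrow> g n = psnd (pfst j)"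
    using delta_function_coding[OF assms] by blast
  interpret coding dk by fact
  have "pr_fun X g" if iso: "isomorphism coded std h" and h: "pr_fun X h" for X h
  proof -
    let ?Q = "\<lambda>j n. pos_rat (h (start n (Suc j))) \<noteq> pos_rat (h (start n j))"
    have "pr_fun X (\<lambda>n. LEAST j. ?Q j n)"
      by (rule pr_fun_least[OF _ _ least_full(2)[OF iso]])
        (unfold start_def, (intro pr_fun_intros pr_pos_rat_eq pr_fun_comp[OF h])+)
    then have "pr_fun X (\<lambda>n. psnd (pfst (LEAST j. ?Q j n)))" by (intro pr_fun_pfst pr_fun_psnd)
    moreover have "g n = psnd (pfst (LEAST j. ?Q j n))" for n
      using least_full(1)[OF iso, of n] dk by (simp add: full_def segment_def)
    ultimately show ?thesis by presburger
  qed
  then show ?thesis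
    using punctual_coded block_order_isomorphic_omega_eta[OF block_order_coded] by blast
qed


section \<open>Punctual categoricity\<close>

lemma pr_le_iff: "f \<le>\<^sub>P\<^sub>R g \<longleftrightarrow> pr_fun {g} f"
  by (simp add: pr_le_def pr_fun_def)

lemma pr_degree_representative:
  assumes "d \<in> pr_degrees"
  obtains g where "\<And>f. pr_le_degree f d \<longleftrightarrow> f \<le>\<^sub>P\<^sub>R g"
proof -
  obtain g where d: "d = pr_equiv `` {g}" using assms by (auto simp: pr_degrees_def quotient_def)
  have "pr_le_degree f d \<longleftrightarrow> f \<le>\<^sub>P\<^sub>R g" for f
    unfolding pr_le_degree_def d pr_equiv_def using pr_le_refl pr_le_trans by blast
  then show thesis by (rule that)
qed

lemma isomorphic_omega_eta_trans:
  "isomorphic A omega_eta \<Longrightarrow> isomorphic B omega_eta \<Longrightarrow> isomorphic B A"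
  unfolding isomorphic_def using isomorphism_comp isomorphism_inv by blast

theorem theorem3p4:
  "(\<exists>A. punctual A \<and> isomorphic A omega_eta) \<and>
   (\<forall>A. punctual A \<and> isomorphic A omega_eta \<longrightarrow> PrCat A = Cone (delta_functions 3))"
proof (intro conjI allI impI)
  have std: "punctual std" "isomorphic std omega_eta"
    using punctual_std block_order_isomorphic_omega_eta[OF block_order_std] by auto
  then show "\<exists>A. punctual A \<and> isomorphic A omega_eta" by blast
  fix A assume A: "punctual A \<and> isomorphic A omega_eta"
  show "PrCat A = Cone (delta_functions 3)"
  proof (intro equalityI subsetI)
    fix d assume d: "d \<in> PrCat A"
    then obtain e where e: "\<And>f. pr_le_degree f d \<longleftrightarrow> f \<le>\<^sub>P\<^sub>R e"
      using pr_degree_representative by (auto simp: PrCat_def)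
    have iso: "\<exists>f. isomorphism A B f \<and> pr_fun {e} f \<and> pr_fun {e} (inv f)"
      if "punctual B" "isomorphic B omega_eta" for B
      using d that A isomorphic_omega_eta_trans by (auto simp: PrCat_def e pr_le_iff)
    have "pr_le_degree g d" if g: "g \<in> delta_functions 3" for g
    proof -
      obtain B where B: "punctual B" "isomorphic B omega_eta"
        and coded: "\<And>X h. isomorphism B std h \<Longrightarrow> pr_fun X h \<Longrightarrow> pr_fun X g"
        using delta_function_from_isomorphism[OF g] by blast
      obtain f where f: "isomorphism A std f" "pr_fun {e} f" using iso[OF std] by blast
      obtain f' where f': "isomorphism A B f'" "pr_fun {e} (inv f')" using iso[OF B] by blast
      \<comment> \<open>The isomorphism from \<open>B\<close> to \<open>std\<close> passes through
        \<open>A\<close>, which uses the bound on the inverse of \<open>f'\<close> in the definition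
        of \<open>PrCat\<close>.\<close>
      have "isomorphism B std (f \<circ> inv f')" by (rule isomorphism_comp[OF isomorphism_inv[OF f'(1)] f(1)])
      moreover have "pr_fun {e} (f \<circ> inv f')" unfolding comp_def by (rule pr_fun_comp[OF f(2) f'(2)])
      ultimately show ?thesis unfolding e pr_le_iff by (rule coded)
    qed
    with d show "d \<in> Cone (delta_functions 3)" by (auto simp: PrCat_def Cone_def)
  next
    fix d assume d: "d \<in> Cone (delta_functions 3)"
    have "\<exists>f. isomorphism A B f \<and> pr_le_degree f d \<and> pr_le_degree (inv f) d"
      if "punctual B" "isomorphic B A" for B
    proof -
      have "isomorphic B omega_eta"
        using that(2) A isomorphism_comp unfolding isomorphic_def by blast
      then show ?thesis
        using delta_isomorphism_omega_eta[of A B] A that(1) d by (auto simp: Cone_def)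
    qed
    with d show "d \<in> PrCat A" by (auto simp: PrCat_def Cone_def)
  qed
qed

end
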